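(* There exists a connected simple real-representable matroid $M$ of rank six on twelve elements such that $a_\ell(M)<0$ for infinitely many $\ell$, where $a_\ell(M)=(-1)^\ell[q^\ell]\operatorname{Mag}(M;q)$.
   Context: For a finite matroid $M$ on $E$ with rank function $r_M$ and $r(M)=r_M(E)$, $\chi_M(x)=\sum_{S\subseteq E}(-1)^{|S|}x^{r(M)-r_M(S)}$. For $w\in\mathbb Z_{\ge0}^E$ put $|w|=\sum_ew_e$, $\operatorname{wt}_M(w)=\max_B\sum_{e\in B}w_e$ over bases $B$ of $M$; the maximizing bases are the bases of the initial matroid $M_w$ on $E$. The motivic zeta function is $Z_M(x,T)=\sum_{w\in\mathbb Z_{\ge0}^E}\chi_{M_w}(x)x^{-r(M)-\operatorname{wt}_M(w)}T^{|w|}\in\mathbb Z[x^{\pm1}][[T]]$, and the magnitude of $M$ is $\operatorname{Mag}(M;q)=Z_M(-1,q)\in\mathbb Z[[q]]$. Thus $\operatorname{Mag}(M;-t)=\sum_{\ell\ge0}a_\ell(M)t^\ell$. A matroid is connected if it is not a direct sum of two matroids with nonempty ground sets. *)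

theory Defs
  imports
    Complex_Main
    "HOL-Library.Poly_Mapping"
    "HOL-Computational_Algebra.Formal_Power_Series"
begin

section \<open>Finite matroids\<close>

record 'a matroid =
  ground :: "'a set"
  indeps :: "'a set set"

locale matroid =
  fixes M :: "'a matroid"
  assumes finite_ground: "finite (ground M)"
    and indeps_subset: "I \<in> indeps M \<Longrightarrow> I \<subseteq> ground M"
    and empty_indep: "{} \<in> indeps M"
    and indep_mono: "J \<in> indeps M \<Longrightarrow> I \<subseteq> J \<Longrightarrow> I \<in> indeps M"
    and indep_augment: "I \<in> indeps M \<Longrightarrow> J \<in> indeps M \<Longrightarrow> card I < card J \<Longrightarrow>
      \<exists>e \<in> J - I. insert e I \<in> indeps M"

definition matroid_rank :: "'a matroid \<Rightarrow> 'a set \<Rightarrow> nat" where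
  "matroid_rank M S = Max (card ` {I \<in> indeps M. I \<subseteq> S})"

definition matroid_bases :: "'a matroid \<Rightarrow> 'a set set" where
  "matroid_bases M = {B \<in> indeps M. \<forall>I \<in> indeps M. B \<subseteq> I \<longrightarrow> I = B}"

definition matroid_loop :: "'a matroid \<Rightarrow> 'a \<Rightarrow> bool" where
  "matroid_loop M e \<longleftrightarrow> e \<in> ground M \<and> {e} \<notin> indeps M"

definition matroid_parallel :: "'a matroid \<Rightarrow> 'a \<Rightarrow> 'a \<Rightarrow> bool" where
  "matroid_parallel M e f \<longleftrightarrow>
     e \<noteq> f \<and> {e} \<in> indeps M \<and> {f} \<in> indeps M \<and> {e, f} \<notin> indeps M"

definition matroid_simple :: "'a matroid \<Rightarrow> bool" where
  "matroid_simple M \<longleftrightarrow> (\<nexists>e. matroid_loop M e) \<and> (\<nexists>e f. matroid_parallel M e f)"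

definition matroid_direct_sum :: "'a matroid \<Rightarrow> 'a matroid \<Rightarrow> 'a matroid" where
  "matroid_direct_sum M N =
     \<lparr>ground = ground M \<union> ground N,
      indeps = {I \<union> J | I J. I \<in> indeps M \<and> J \<in> indeps N}\<rparr>"

definition matroid_connected :: "'a matroid \<Rightarrow> bool" where
  "matroid_connected M \<longleftrightarrow>
     \<not> (\<exists>M1 M2. matroid M1 \<and> matroid M2 \<and> ground M1 \<noteq> {} \<and> ground M2 \<noteq> {} \<and>
        ground M1 \<inter> ground M2 = {} \<and> M = matroid_direct_sum M1 M2)"

text \<open>
  \<open>M\<close> is the vector matroid of a real matrix \<open>A\<close> with \<open>n\<close> rows and columns indexed by the
  ground set: a set of elements is independent iff the corresponding family of columns is
  linearly independent over \<open>\<real>\<close> (so repeated columns are dependent).  Linear independence is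
  spelled out because the number of rows is a quantified number rather than a type.
\<close>

definition real_representable :: "'a matroid \<Rightarrow> bool" where
  "real_representable M \<longleftrightarrow>
     (\<exists>(n::nat) (A :: nat \<Rightarrow> 'a \<Rightarrow> real). indeps M =
        {I. I \<subseteq> ground M \<and>
            (\<forall>c :: 'a \<Rightarrow> real. (\<forall>i<n. (\<Sum>e\<in>I. c e * A i e) = 0) \<longrightarrow> (\<forall>e\<in>I. c e = 0))})"


section \<open>Motivic zeta function and magnitude\<close>

text \<open>
  \<open>\<int>[x, x\<^sup>-\<^sup>1]\<close> is the ring of finitely supported functions \<open>\<int> \<Rightarrow> \<int>\<close> under convolution;
  \<^term>\<open>Poly_Mapping.single k c\<close> is the Laurent monomial with coefficient \<open>c\<close> and exponent \<open>k\<close>.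
\<close>

type_synonym laurent_poly = "int \<Rightarrow>\<^sub>0 int"

text \<open>Since \<open>int\<close> has no inverses, \<open>(-1)\<^sup>k\<close> is written with exponent \<open>\<bar>k\<bar>\<close>, which has the same parity.\<close>

definition laurent_at_minus_one :: "laurent_poly \<Rightarrow> int" where
  "laurent_at_minus_one p =
     (\<Sum>k \<in> Poly_Mapping.keys p. Poly_Mapping.lookup p k * (-1) ^ nat \<bar>k\<bar>)"

definition matroid_charpoly :: "'a matroid \<Rightarrow> laurent_poly" where
  "matroid_charpoly M =
     (\<Sum>S \<in> Pow (ground M).
        Poly_Mapping.single
          (int (matroid_rank M (ground M)) - int (matroid_rank M S)) ((-1) ^ card S))"

definition matroid_wt :: "'a matroid \<Rightarrow> ('a \<Rightarrow> nat) \<Rightarrow> nat" where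
  "matroid_wt M w = Max ((\<lambda>B. \<Sum>e\<in>B. w e) ` matroid_bases M)"

text \<open>The independent sets of the initial matroid are the subsets of the maximum-weight bases.\<close>

definition initial_matroid :: "'a matroid \<Rightarrow> ('a \<Rightarrow> nat) \<Rightarrow> 'a matroid" where
  "initial_matroid M w =
     \<lparr>ground = ground M,
      indeps = {I. \<exists>B \<in> matroid_bases M. (\<Sum>e\<in>B. w e) = matroid_wt M w \<and> I \<subseteq> B}\<rparr>"

text \<open>
  The vectors \<open>w \<in> \<int>\<^sub>\<ge>\<^sub>0\<^sup>E\<close> with \<open>|w| = n\<close>, extended by \<open>0\<close> outside \<open>E\<close> so that each vector is
  represented by exactly one function.
\<close>

definition weight_vectors :: "'a set \<Rightarrow> nat \<Rightarrow> ('a \<Rightarrow> nat) set" where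
  "weight_vectors E n = {w. (\<forall>e. e \<notin> E \<longrightarrow> w e = 0) \<and> (\<Sum>e\<in>E. w e) = n}"

text \<open>The sum over weight vectors below is therefore a genuine finite sum.\<close>

lemma finite_weight_vectors:
  assumes "finite E"
  shows "finite (weight_vectors E n)"
proof (rule finite_subset)
  show "weight_vectors E n \<subseteq> {w. \<forall>e. (e \<in> E \<longrightarrow> w e \<in> {..n}) \<and> (e \<notin> E \<longrightarrow> w e = 0)}"
    using member_le_sum[of _ E] assms by (fastforce simp: weight_vectors_def)
  show "finite {w. \<forall>e. (e \<in> E \<longrightarrow> w e \<in> {..n}) \<and> (e \<notin> E \<longrightarrow> w e = (0::nat))}"
    using assms by (intro finite_set_of_finite_funs) auto
qed

text \<open>An element of \<open>\<int>[x, x\<^sup>-\<^sup>1][[T]]\<close>, with the terms of the sum over \<open>w\<close> grouped by \<open>|w|\<close>.\<close>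

definition motivic_zeta :: "'a matroid \<Rightarrow> laurent_poly fps" where
  "motivic_zeta M = Abs_fps (\<lambda>n. \<Sum>w \<in> weight_vectors (ground M) n.
     matroid_charpoly (initial_matroid M w) *
     Poly_Mapping.single (- int (matroid_rank M (ground M)) - int (matroid_wt M w)) 1)"

definition magnitude :: "'a matroid \<Rightarrow> int fps" where
  "magnitude M = Abs_fps (\<lambda>n. laurent_at_minus_one (fps_nth (motivic_zeta M) n))"

definition magnitude_coeff :: "'a matroid \<Rightarrow> nat \<Rightarrow> int" where
  "magnitude_coeff M l = (-1) ^ l * fps_nth (magnitude M) l"

end

theory Submission
  imports Defs "HOL-Analysis.FPS_Convergence"
begin

text \<open>
  Only weight vectors all of whose level sets are flats contribute, so
  \<open>f(t) = Mag(M; -t)\<close> is a sum over chains of flats of terms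
  \<open>\<epsilon>(F) t\<^sup>|\<^sup>F\<^sup>| / (1 - \<epsilon>(F) t\<^sup>|\<^sup>F\<^sup>|)\<close> with \<open>\<epsilon>(F) = (-1)\<^sup>|\<^sup>F\<^sup>|\<^sup>+\<^sup>r\<^sup>(\<^sup>F\<^sup>)\<close>.
  Flats of even nullity have a pole at \<open>1\<close>. In rank six the order of \<open>f\<close> at \<open>1\<close> is at most
  six, and it drops to four if no complete flag consists of flats of even nullity, because the
  contributions of order five cancel. At \<open>\<i>\<close> a flag of flats with
  \<open>4, 6, 8, 10, 12\<close> elements produces a pole of order five with nonzero leading coefficient. If almost
  all \<open>a\<^sub>l\<close> were nonnegative, then \<open>\<bar>f(\<i> r)\<bar> \<le> f(r) + C\<close> for \<open>0 < r < 1\<close>, which is impossible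
  as \<open>r\<close> tends to \<open>1\<close>.
  A matroid with both properties is obtained by gluing one four-point line and four three-point
  lines along a tree (parallel connections at points).
\<close>

section \<open>Rank and initial matroids\<close>

text \<open>Radial limits reveal negative coefficients only if the order at \<open>\<i>\<close>
  exceeds the order at 1, so the order at 1 has to fall below five, not merely below six. Without
  even flags, order five at 1 still receives chains with one odd flat and chains that skip one rank.
  An odd flat contributes a factor -1 / (1 + 1), a skipped rank twice the number of intermediate
  flats, and that makes the two kinds cancel. At \<open>\<i>\<close> a single point has factor
  \<open>\<i>\<close> and no pole, so five is the largest possible order there. The leading
  coefficients cannot cancel each other because every line yields \<open>\<i>\<close> times a
  nonnegative real and all later factors are positive. The sizes 4, 6, 8, 10, 12 come from asking
  for i-th flats of rank i with 2i elements: their nullity is i, so the sign and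
  \<open>\<i> ^ (2 * i)\<close> are both \<open>(-1) ^ i\<close> and their product is 1. A
  four-point line starts such a flag, and each three-point line glued on adds one to the rank and
  two elements. Attaching the last two lines at the two different points 6 and 7 of one line is what
  keeps even flags from reaching the ground set.\<close>

context matroid
begin

abbreviation rk :: "'a set \<Rightarrow> nat" where "rk \<equiv> matroid_rank M"

lemma finite_indep: "I \<in> indeps M \<Longrightarrow> finite I"
  using finite_ground finite_subset indeps_subset by blast

lemma finite_indeps: "finite {I \<in> indeps M. P I}"
  by (rule finite_subset[of _ "Pow (ground M)"]) (use finite_ground indeps_subset in auto)

lemma rank_ge_card: "I \<in> indeps M \<Longrightarrow> I \<subseteq> S \<Longrightarrow> card I \<le> rk S"
  unfolding matroid_rank_def by (rule Max_ge) (auto intro: finite_indeps)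

lemma ex_indep_card_eq_rank: "\<exists>I\<in>indeps M. I \<subseteq> S \<and> card I = rk S"
proof -
  have "rk S \<in> card ` {I \<in> indeps M. I \<subseteq> S}"
    unfolding matroid_rank_def by (rule Max_in) (use finite_indeps empty_indep in auto)
  then show ?thesis by auto
qed

lemma extend_indep:
  assumes "I \<in> indeps M" "I \<subseteq> S"
  obtains J where "J \<in> indeps M" "I \<subseteq> J" "J \<subseteq> S" "card J = rk S"
proof -
  define P where "P J \<longleftrightarrow> J \<in> indeps M \<and> I \<subseteq> J \<and> J \<subseteq> S" for J
  have "\<exists>J. P J \<and> (\<forall>K. P K \<longrightarrow> card K \<le> card J)"
    by (rule ex_has_greatest_nat[of P I card "Suc (rk S)"])
      (use assms rank_ge_card in \<open>auto simp: P_def less_Suc_eq_le\<close>)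
  then obtain J where J: "P J" "\<And>K. P K \<Longrightarrow> card K \<le> card J"
    by blast
  have "card J = rk S"
  proof (rule ccontr)
    assume "card J \<noteq> rk S"
    with J have "card J < rk S"
      using rank_ge_card[of J S] by (auto simp: P_def)
    moreover obtain K where K: "K \<in> indeps M" "K \<subseteq> S" "card K = rk S"
      using ex_indep_card_eq_rank by blast
    ultimately obtain e where e: "e \<in> K - J" "insert e J \<in> indeps M"
      using indep_augment[of J K] J(1) P_def by metis
    then have "P (insert e J)" using J(1) K by (auto simp: P_def)
    from J(2)[OF this] e J(1) finite_indep show False
      by (auto simp: P_def)
  qed
  with J(1) that show thesis by (auto simp: P_def)
qed

lemma rank_mono: "S \<subseteq> T \<Longrightarrow> rk S \<le> rk T"
  using ex_indep_card_eq_rank[of S] rank_ge_card[of _ T] by (metis subset_trans)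

lemma rank_le_card: "finite S \<Longrightarrow> rk S \<le> card S"
  using ex_indep_card_eq_rank[of S] card_mono by metis

lemma rank_empty [simp]: "rk {} = 0"
  using rank_le_card[of "{}"] by simp

lemma rank_indep: "I \<in> indeps M \<Longrightarrow> rk I = card I"
  using rank_ge_card[of I I] rank_le_card[of I] finite_indep by (simp add: order_antisym)

lemma rank_insert_le: "rk (insert e S) \<le> Suc (rk S)"
proof -
  obtain I where I: "I \<in> indeps M" "I \<subseteq> insert e S" "card I = rk (insert e S)"
    using ex_indep_card_eq_rank by blast
  have "card (I - {e}) \<le> rk S"
    using I indep_mono by (intro rank_ge_card) auto
  then show ?thesis using I by (simp add: card_Diff_singleton_if split: if_splits)
qed

text \<open>Local form of submodularity, from which the facts about closures below are derived. If
  \<open>e\<close> raised the rank of \<open>Y\<close>, a maximal independent set of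
  \<open>insert e Y\<close> grown from one of \<open>X\<close> would contain \<open>e\<close>, and
  so \<open>e\<close> would already raise the rank of \<open>X\<close>.\<close>

lemma rank_insert_eq_mono:
  assumes "rk (insert e X) = rk X" "X \<subseteq> Y"
  shows "rk (insert e Y) = rk Y"
proof (rule ccontr)
  assume "rk (insert e Y) \<noteq> rk Y"
  then have lt: "rk Y < rk (insert e Y)"
    using rank_mono[OF subset_insertI, of Y e] by linarith
  obtain I where I: "I \<in> indeps M" "I \<subseteq> X" "card I = rk X"
    using ex_indep_card_eq_rank by blast
  obtain J where J: "J \<in> indeps M" "I \<subseteq> J" "J \<subseteq> Y" "card J = rk Y"
    using extend_indep[of I Y] I assms by blast
  obtain K where K: "K \<in> indeps M" "J \<subseteq> K" "K \<subseteq> insert e Y" "card K = rk (insert e Y)"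
    using extend_indep[of J "insert e Y"] J by blast
  have "e \<in> K" "e \<notin> Y"
    using K J lt rank_ge_card[of K Y] by (auto simp: subset_insert insert_absorb)
  then have "insert e I \<in> indeps M" "e \<notin> I"
    using K I J assms(2) indep_mono[of K "insert e I"] by auto
  then have "Suc (card I) \<le> rk (insert e X)"
    using rank_ge_card[of "insert e I" "insert e X"] finite_indep[of I] I by auto
  with I assms show False by simp
qed

text \<open>Remove the largest member \<open>X\<close>, take a set \<open>B\<close> for the
  remaining chain and extend \<open>B \<inter> X\<close> inside \<open>X\<close>. The traces on the
  smaller members can only grow, and they already have maximal size. Applied to level sets, this
  takes the place of the greedy algorithm.\<close>

lemma adapted_basis:
  assumes "finite C" "\<And>X Y. X \<in> C \<Longrightarrow> Y \<in> C \<Longrightarrow> X \<subseteq> Y \<or> Y \<subseteq> X"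
  shows "\<exists>B\<in>indeps M. \<forall>X\<in>C. card (B \<inter> X) = rk X"
  using assms
proof (induction "card C" arbitrary: C)
  case 0
  then show ?case using empty_indep by auto
next
  case (Suc n)
  then have "C \<noteq> {}" by auto
  from finite_has_maximal[OF Suc.prems(1) this]
  obtain X where "X \<in> C" "\<forall>Y\<in>C. X \<subseteq> Y \<longrightarrow> X = Y"
    by blast
  then have X: "X \<in> C" "\<And>Y. Y \<in> C \<Longrightarrow> Y \<subseteq> X"
    using Suc.prems(2) by metis+
  have "\<exists>B\<in>indeps M. \<forall>Y\<in>C - {X}. card (B \<inter> Y) = rk Y"
    using Suc X(1) by (intro Suc.hyps) auto
  then obtain B where B: "B \<in> indeps M" "\<And>Y. Y \<in> C - {X} \<Longrightarrow> card (B \<inter> Y) = rk Y"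
    by auto
  obtain J where J: "J \<in> indeps M" "B \<inter> X \<subseteq> J" "J \<subseteq> X" "card J = rk X"
    using extend_indep[of "B \<inter> X" X] indep_mono[OF B(1)] by blast
  have "card (J \<inter> Y) = rk Y" if "Y \<in> C" for Y
  proof (cases "Y = X")
    case True
    then show ?thesis using J by (simp add: Int_absorb2)
  next
    case False
    have "card (B \<inter> Y) \<le> card (J \<inter> Y)"
      using J X(2)[OF that] finite_indep by (intro card_mono) auto
    moreover have "card (J \<inter> Y) \<le> rk Y"
      using J indep_mono by (intro rank_ge_card) auto
    ultimately show ?thesis using B that False by force
  qed
  then show ?case using J by blast
qed

lemma mem_bases_iff: "B \<in> matroid_bases M \<longleftrightarrow> B \<in> indeps M \<and> card B = rk (ground M)"
proof
  assume B: "B \<in> matroid_bases M"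
  then have "B \<in> indeps M" by (auto simp: matroid_bases_def)
  moreover from this obtain J
    where "J \<in> indeps M" "B \<subseteq> J" "J \<subseteq> ground M" "card J = rk (ground M)"
    using extend_indep indeps_subset by metis
  ultimately show "B \<in> indeps M \<and> card B = rk (ground M)"
    using B by (auto simp: matroid_bases_def)
next
  assume B: "B \<in> indeps M \<and> card B = rk (ground M)"
  have "I = B" if "I \<in> indeps M" "B \<subseteq> I" for I
    using that B rank_ge_card[of I "ground M"] indeps_subset finite_indep
      card_subset_eq[of I B] card_mono[of I B] by (metis order_antisym)
  with B show "B \<in> matroid_bases M" by (auto simp: matroid_bases_def)
qed

end

section \<open>Level sets and the rank function of the initial matroid\<close>

definition level_set :: "'a set \<Rightarrow> ('a \<Rightarrow> nat) \<Rightarrow> nat \<Rightarrow> 'a set" where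
  "level_set X w k = {e \<in> X. k \<le> w e}"

lemma level_set_0 [simp]: "level_set X w 0 = X"
  by (auto simp: level_set_def)

lemma level_set_antimono: "j \<le> k \<Longrightarrow> level_set X w k \<subseteq> level_set X w j"
  by (auto simp: level_set_def)

lemma level_set_subset: "level_set X w k \<subseteq> X"
  by (auto simp: level_set_def)

lemma card_eq_sum_levels:
  assumes "finite E" "I \<subseteq> E" "\<And>e. e \<in> E \<Longrightarrow> w e \<le> N"
  shows "card I = (\<Sum>k\<le>N. card (I \<inter> (level_set E w k - level_set E w (Suc k))))"
proof -
  have "I = (\<Union>k\<le>N. I \<inter> (level_set E w k - level_set E w (Suc k)))" (is "I = ?R")
  proof
    show "I \<subseteq> ?R"
    proof
      fix e assume "e \<in> I"
      then have "w e \<le> N" "e \<in> I \<inter> (level_set E w (w e) - level_set E w (Suc (w e)))"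
        using assms by (auto simp: level_set_def)
      then show "e \<in> ?R" by blast
    qed
  qed auto
  then have "card I = card (\<Union>k\<le>N. I \<inter> (level_set E w k - level_set E w (Suc k)))"
    by simp
  also have "\<dots> = (\<Sum>k\<le>N. card (I \<inter> (level_set E w k - level_set E w (Suc k))))"
    using assms finite_subset
    by (intro card_UN_disjoint) (auto simp: level_set_def)
  finally show ?thesis .
qed

text \<open>Layer-cake summation: \<open>e\<close> is counted once for each level from 1 to
  \<open>w e\<close>.\<close>

lemma sum_eq_sum_levels:
  assumes "finite E" "B \<subseteq> E" "\<And>e. e \<in> E \<Longrightarrow> w e \<le> N"
  shows "(\<Sum>e\<in>B. w e) = (\<Sum>k<N. card (B \<inter> level_set E w (Suc k)))"
proof -
  have fin: "finite B" using assms finite_subset by blast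
  have "w e = (\<Sum>k<N. if Suc k \<le> w e then 1 else 0)" if "e \<in> B" for e
  proof -
    have "{k. k < N \<and> Suc k \<le> w e} = {..<w e}"
      using assms that by force
    then show ?thesis
      by (simp add: sum.If_cases Int_def Suc_le_eq)
  qed
  then have "(\<Sum>e\<in>B. w e) = (\<Sum>e\<in>B. \<Sum>k<N. if Suc k \<le> w e then 1 else 0)"
    by (rule sum.cong[OF refl])
  also have "\<dots> = (\<Sum>k<N. \<Sum>e\<in>B. if Suc k \<le> w e then 1 else 0)"
    by (rule sum.swap)
  also have "\<dots> = (\<Sum>k<N. card (B \<inter> level_set E w (Suc k)))"
  proof (rule sum.cong[OF refl])
    fix k
    have "B \<inter> {e. Suc k \<le> w e} = B \<inter> level_set E w (Suc k)"
      using assms by (auto simp: level_set_def)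
    then show "(\<Sum>e\<in>B. if Suc k \<le> w e then 1 else 0) = card (B \<inter> level_set E w (Suc k))"
      using fin by (simp add: sum.If_cases Int_def)
  qed
  finally show ?thesis .
qed

text \<open>\<open>N\<close> only cuts off the sums over levels. It is instantiated below by the
  total weight of \<open>w\<close>.\<close>

locale weighted_matroid = matroid M for M :: "'a matroid" +
  fixes w :: "'a \<Rightarrow> nat" and N :: nat
  assumes weight_le: "e \<in> ground M \<Longrightarrow> w e \<le> N"
begin

abbreviation U :: "nat \<Rightarrow> 'a set" where "U \<equiv> level_set (ground M) w"

lemma level_Suc_N [simp]: "U (Suc N) = {}"
  using weight_le by (fastforce simp: level_set_def)

lemma weight_basis_le:
  assumes "B \<in> indeps M"
  shows "card (B \<inter> U k) \<le> rk (U k)"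
  using assms indep_mono by (intro rank_ge_card) auto

text \<open>By layer-cake summation the weight of a basis is a sum of traces on level sets, each
  bounded by a rank. A set adapted to the chain of level sets attains all these bounds at
  once.\<close>

lemma wt_eq: "matroid_wt M w = (\<Sum>k<N. rk (U (Suc k)))"
  unfolding matroid_wt_def
proof (rule Max_eqI)
  have "finite (matroid_bases M)"
    using finite_indeps by (simp add: matroid_bases_def)
  then show "finite ((\<lambda>B. \<Sum>e\<in>B. w e) ` matroid_bases M)" by blast
next
  fix y assume "y \<in> (\<lambda>B. \<Sum>e\<in>B. w e) ` matroid_bases M"
  then obtain B where B: "B \<in> indeps M" "y = (\<Sum>e\<in>B. w e)"
    by (auto simp: matroid_bases_def)
  then show "y \<le> (\<Sum>k<N. rk (U (Suc k)))"
    using sum_eq_sum_levels[OF finite_ground indeps_subset[OF B(1)] weight_le] weight_basis_le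
    by (auto intro: sum_mono)
next
  have "\<exists>B\<in>indeps M. \<forall>X\<in>U ` {..N}. card (B \<inter> X) = rk X"
  proof (rule adapted_basis)
    fix X Y assume "X \<in> U ` {..N}" "Y \<in> U ` {..N}"
    then obtain j k where "X = U j" "Y = U k" by blast
    then show "X \<subseteq> Y \<or> Y \<subseteq> X"
      using level_set_antimono nat_le_linear by metis
  qed auto
  then obtain B where B: "B \<in> indeps M" "\<And>k. k \<le> N \<Longrightarrow> card (B \<inter> U k) = rk (U k)"
    by auto
  have "B \<in> matroid_bases M"
    using B(1) B(2)[of 0] indeps_subset[OF B(1)] by (simp add: mem_bases_iff Int_absorb2)
  moreover have "(\<Sum>e\<in>B. w e) = (\<Sum>k<N. rk (U (Suc k)))"
    using sum_eq_sum_levels[OF finite_ground indeps_subset[OF B(1)] weight_le] B(2) by simp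
  ultimately show "(\<Sum>k<N. rk (U (Suc k))) \<in> (\<lambda>B. \<Sum>e\<in>B. w e) ` matroid_bases M"
    by force
qed

text \<open>Equality in a sum of termwise bounds forces equality in every term. Level 0 is the
  condition of being a basis, and the levels above \<open>N\<close> are empty.\<close>

lemma max_weight_basis_iff:
  assumes "B \<in> matroid_bases M"
  shows "(\<Sum>e\<in>B. w e) = matroid_wt M w \<longleftrightarrow> (\<forall>k. card (B \<inter> U k) = rk (U k))"
proof -
  have B: "B \<in> indeps M" "card (B \<inter> U 0) = rk (U 0)"
    using assms indeps_subset by (auto simp: mem_bases_iff Int_absorb2)
  have big: "U k = {}" if "k > N" for k
    using level_set_antimono[of "Suc N" k "ground M" w] that by auto
  have "(\<Sum>e\<in>B. w e) = matroid_wt M w \<longleftrightarrow> (\<forall>k<N. card (B \<inter> U (Suc k)) = rk (U (Suc k)))"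
    using sum_eq_sum_levels[OF finite_ground indeps_subset[OF B(1)] weight_le]
      weight_basis_le[OF B(1)]
    by (auto simp: wt_eq intro: sum_mono_inv)
  also have "\<dots> \<longleftrightarrow> (\<forall>k. card (B \<inter> U k) = rk (U k))"
  proof (intro iffI allI)
    fix k assume *: "\<forall>k<N. card (B \<inter> U (Suc k)) = rk (U (Suc k))"
    show "card (B \<inter> U k) = rk (U k)"
      using * B(2) big by (cases k; cases "k > N") auto
  qed auto
  finally show ?thesis .
qed

text \<open>The initial matroid is the direct sum, over \<open>k\<close>, of the minors obtained
  from the restriction to \<open>U k\<close> by contracting \<open>U (Suc k)\<close>; the right-hand
  side is the rank in that sum. For the upper bound, the part of \<open>I\<close> in layer
  \<open>k\<close> is joined to the trace of a maximal basis on \<open>U (Suc k)\<close>.\<close>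

lemma rank_initial_matroid:
  assumes "T \<subseteq> ground M"
  shows "matroid_rank (initial_matroid M w) T =
    (\<Sum>k\<le>N. rk (U (Suc k) \<union> T \<inter> U k) - rk (U (Suc k)))"
  unfolding matroid_rank_def[of "initial_matroid M w"]
proof (rule Max_eqI)
  have "finite (Pow T)" using assms finite_ground finite_subset by blast
  then show "finite (card ` {I \<in> indeps (initial_matroid M w). I \<subseteq> T})"
    by (auto intro: finite_subset[of _ "Pow T"])
next
  fix y assume "y \<in> card ` {I \<in> indeps (initial_matroid M w). I \<subseteq> T}"
  then obtain I B where I: "y = card I" "I \<subseteq> T" "I \<subseteq> B" "B \<in> matroid_bases M"
    and B: "\<And>k. card (B \<inter> U k) = rk (U k)"
    using max_weight_basis_iff by (auto simp: initial_matroid_def)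
  have Bi: "B \<in> indeps M" using I by (simp add: mem_bases_iff)
  have fin: "finite B" using finite_indep[OF Bi] .
  have "card (I \<inter> (U k - U (Suc k))) \<le> rk (U (Suc k) \<union> T \<inter> U k) - rk (U (Suc k))" for k
  proof -
    have "card (I \<inter> (U k - U (Suc k))) + card (B \<inter> U (Suc k)) =
        card (I \<inter> (U k - U (Suc k)) \<union> B \<inter> U (Suc k))"
      using fin finite_subset[OF I(3)] by (intro card_Un_disjoint[symmetric]) auto
    also have "\<dots> \<le> rk (U (Suc k) \<union> T \<inter> U k)"
      using I by (intro rank_ge_card indep_mono[OF Bi]) auto
    finally show ?thesis using B by simp
  qed
  then show "y \<le> (\<Sum>k\<le>N. rk (U (Suc k) \<union> T \<inter> U k) - rk (U (Suc k)))"
    using I(1,2) assms card_eq_sum_levels[OF finite_ground _ weight_le, of I]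
    by (auto intro: sum_mono)
next
  \<comment> \<open>\<open>V k\<close> lies between the consecutive level sets
    \<open>U (Suc k)\<close> and \<open>U k\<close>, so the \<open>U\<close>s and \<open>V\<close>s
    together still form a chain. A basis adapted to this chain has maximal weight and meets every
    layer of \<open>T\<close> in as many elements as the bound allows.\<close>
  define V where "V k = U (Suc k) \<union> T \<inter> U k" for k
  have V: "U (Suc k) \<subseteq> V k" "V k \<subseteq> U k" for k
    by (auto simp: V_def level_set_def)
  have mono: "U k \<subseteq> U j" if "j \<le> k" for j k
    by (rule level_set_antimono[OF that])
  have UV: "U k \<subseteq> V j \<or> V j \<subseteq> U k" for j k
    using V[of j] mono[of "Suc j" k] mono[of k j] by (cases "j < k") auto
  have VV: "V k \<subseteq> V j \<or> V j \<subseteq> V k" for j k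
  proof (cases j k rule: linorder_cases)
    case less
    then show ?thesis using V[of j] V[of k] mono[of "Suc j" k] by auto
  next
    case greater
    then show ?thesis using V[of j] V[of k] mono[of "Suc k" j] by auto
  qed auto
  have "\<exists>B\<in>indeps M. \<forall>X\<in>U ` {..Suc N} \<union> V ` {..N}. card (B \<inter> X) = rk X"
  proof (rule adapted_basis)
    have UU: "U j \<subseteq> U k \<or> U k \<subseteq> U j" for j k
      using mono nat_le_linear by metis
    fix X Y assume "X \<in> U ` {..Suc N} \<union> V ` {..N}" "Y \<in> U ` {..Suc N} \<union> V ` {..N}"
    then obtain j k where "X = U j \<or> X = V j" "Y = U k \<or> Y = V k" by blast
    then show "X \<subseteq> Y \<or> Y \<subseteq> X"
      using UU[of j k] UV[of j k] UV[of k j] VV[of j k] by metis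
  qed auto
  then obtain B where B: "B \<in> indeps M" "\<And>k. k \<le> Suc N \<Longrightarrow> card (B \<inter> U k) = rk (U k)"
    "\<And>k. k \<le> N \<Longrightarrow> card (B \<inter> V k) = rk (V k)"
    by auto
  have basis: "B \<in> matroid_bases M"
    using B(1) B(2)[of 0] indeps_subset[OF B(1)] by (simp add: mem_bases_iff Int_absorb2)
  have "card (B \<inter> U k) = rk (U k)" for k
  proof (cases "k \<le> N")
    case False
    then have "U k = {}"
      using level_set_antimono[of "Suc N" k "ground M" w] by auto
    then show ?thesis by simp
  qed (use B in simp)
  then have "(\<Sum>e\<in>B. w e) = matroid_wt M w"
    using max_weight_basis_iff[OF basis] by blast
  then have "B \<inter> T \<in> indeps (initial_matroid M w)"
    using basis by (auto simp: initial_matroid_def)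
  moreover have "card (B \<inter> T) = (\<Sum>k\<le>N. rk (V k) - rk (U (Suc k)))"
  proof -
    have "card (B \<inter> T) = (\<Sum>k\<le>N. card (B \<inter> T \<inter> (U k - U (Suc k))))"
      using card_eq_sum_levels[OF finite_ground _ weight_le, of "B \<inter> T" "\<lambda>e. e"] assms by auto
    also have "\<dots> = (\<Sum>k\<le>N. rk (V k) - rk (U (Suc k)))"
    proof (rule sum.cong[OF refl])
      fix k assume "k \<in> {..N}"
      have "B \<inter> T \<inter> (U k - U (Suc k)) = B \<inter> V k - B \<inter> U (Suc k)"
        by (auto simp: V_def)
      then have "card (B \<inter> T \<inter> (U k - U (Suc k))) = card (B \<inter> V k) - card (B \<inter> U (Suc k))"
        using V(1)[of k] finite_indep[OF B(1)] by (metis Int_mono card_Diff_subset finite_Int order_refl)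
      then show "card (B \<inter> T \<inter> (U k - U (Suc k))) = rk (V k) - rk (U (Suc k))"
        using B \<open>k \<in> {..N}\<close> by simp
    qed
    finally show ?thesis .
  qed
  ultimately show "(\<Sum>k\<le>N. rk (U (Suc k) \<union> T \<inter> U k) - rk (U (Suc k)))
      \<in> card ` {I \<in> indeps (initial_matroid M w). I \<subseteq> T}"
    by (force simp: V_def)
qed

lemma rank_initial_matroid_ground:
  "matroid_rank (initial_matroid M w) (ground M) = rk (ground M)"
proof -
  have le: "rk (U (Suc k)) \<le> rk (U k)" for k
    by (intro rank_mono level_set_antimono) auto
  have "(\<Sum>k\<le>n. rk (U k) - rk (U (Suc k))) = rk (U 0) - rk (U (Suc n))" for n
  proof (induction n)
    case (Suc n)
    have "rk (U (Suc n)) \<le> rk (U 0)"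
      by (intro rank_mono level_set_antimono) auto
    with Suc le[of "Suc n"] show ?case by simp
  qed simp
  moreover have "U (Suc k) \<union> ground M \<inter> U k = U k" for k
    using level_set_antimono[of k "Suc k" "ground M" w] level_set_subset[of "ground M" w k] by auto
  ultimately show ?thesis
    by (simp add: rank_initial_matroid)
qed

end

section \<open>Level sets of a weight vector\<close>

lemma laurent_at_minus_one_superset:
  assumes "finite K" "Poly_Mapping.keys p \<subseteq> K"
  shows "laurent_at_minus_one p = (\<Sum>k\<in>K. Poly_Mapping.lookup p k * (-1) ^ nat \<bar>k\<bar>)"
  unfolding laurent_at_minus_one_def
  using assms by (intro sum.mono_neutral_left) (auto simp: in_keys_iff)

lemma laurent_at_minus_one_add:
  "laurent_at_minus_one (p + q) = laurent_at_minus_one p + laurent_at_minus_one q"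
proof -
  let ?K = "Poly_Mapping.keys p \<union> Poly_Mapping.keys q"
  have "Poly_Mapping.keys (p + q) \<subseteq> ?K" by (rule Poly_Mapping.keys_add)
  then show ?thesis
    using laurent_at_minus_one_superset[of ?K p] laurent_at_minus_one_superset[of ?K q]
      laurent_at_minus_one_superset[of ?K "p + q"]
    by (simp add: lookup_add ring_distribs sum.distrib)
qed

lemma laurent_at_minus_one_sum:
  "laurent_at_minus_one (\<Sum>x\<in>A. f x) = (\<Sum>x\<in>A. laurent_at_minus_one (f x))"
  by (induction A rule: infinite_finite_induct)
    (simp_all add: laurent_at_minus_one_add, simp_all add: laurent_at_minus_one_def)

lemma laurent_at_minus_one_single:
  "laurent_at_minus_one (Poly_Mapping.single k c) = c * (-1) ^ nat \<bar>k\<bar>"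
  by (simp add: laurent_at_minus_one_def)

lemma sum_Pow_union:
  assumes "A \<inter> B = {}"
  shows "(\<Sum>S\<in>Pow (A \<union> B). f S) = (\<Sum>S\<in>Pow A. \<Sum>T\<in>Pow B. f (S \<union> T))"
proof -
  have "(\<Sum>S\<in>Pow (A \<union> B). f S) = (\<Sum>(S, T)\<in>Pow A \<times> Pow B. f (S \<union> T))"
    by (rule sum.reindex_bij_witness[of _ "\<lambda>(S, T). S \<union> T" "\<lambda>S. (S \<inter> A, S \<inter> B)"])
      (use assms in \<open>auto intro!: arg_cong[of _ _ f]\<close>)
  then show ?thesis by (simp add: sum.cartesian_product)
qed

text \<open>Distributivity: a subset of the union of the layers amounts to one independent choice in
  each layer.\<close>

lemma sum_Pow_prod_levels:
  fixes f :: "nat \<Rightarrow> 'a set \<Rightarrow> 'b::comm_semiring_1"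
  assumes "\<And>j k. j \<le> k \<Longrightarrow> V k \<subseteq> V j"
  shows "(\<Sum>S\<in>Pow (V 0 - V n). \<Prod>k<n. f k (S \<inter> (V k - V (Suc k)))) =
    (\<Prod>k<n. \<Sum>T\<in>Pow (V k - V (Suc k)). f k T)"
proof (induction n)
  case (Suc n)
  have V: "V 0 - V (Suc n) = (V 0 - V n) \<union> (V n - V (Suc n))"
    using assms[of 0 n] assms[of n "Suc n"] by auto
  have "(S \<union> T) \<inter> (V n - V (Suc n)) = T"
    if "S \<in> Pow (V 0 - V n)" "T \<in> Pow (V n - V (Suc n))" for S T
    using that by auto
  moreover have "(S \<union> T) \<inter> (V k - V (Suc k)) = S \<inter> (V k - V (Suc k))"
    if "S \<in> Pow (V 0 - V n)" "T \<in> Pow (V n - V (Suc n))" "k < n" for S T k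
    using that assms[of "Suc k" n] by auto
  ultimately
  have "(\<Sum>S\<in>Pow (V 0 - V (Suc n)). \<Prod>k<Suc n. f k (S \<inter> (V k - V (Suc k)))) =
    (\<Sum>S\<in>Pow (V 0 - V n). \<Sum>T\<in>Pow (V n - V (Suc n)).
      (\<Prod>k<n. f k (S \<inter> (V k - V (Suc k)))) * f n T)"
    unfolding V by (subst sum_Pow_union) (auto intro!: sum.cong)
  also have "\<dots> = (\<Prod>k<Suc n. \<Sum>T\<in>Pow (V k - V (Suc k)). f k T)"
    by (simp add: Suc sum_distrib_left[symmetric] sum_distrib_right[symmetric])
  finally show ?case .
qed simp

lemma minus_one_power_diff: "b \<le> a \<Longrightarrow> (-1) ^ (a - b) = ((-1) ^ (a + b) :: int)"
  by (simp add: uminus_power_if)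

context matroid
begin

text \<open>The sum of size and rank has the parity of the nullity and avoids a subtraction.\<close>

definition nullity_sign :: "'a set \<Rightarrow> int" where
  "nullity_sign X = (-1) ^ (card X + rk X)"

text \<open>Up to the sign \<open>(-1) ^ (rk X - rk Y)\<close>, this is the characteristic
  polynomial at -1 of the minor on \<open>X - Y\<close> obtained from the restriction to
  \<open>X\<close> by contracting \<open>Y\<close>. With this sign the values needed below are
  positive.\<close>

definition minor_sum :: "'a set \<Rightarrow> 'a set \<Rightarrow> int" where
  "minor_sum Y X = (\<Sum>T\<in>Pow (X - Y). (-1) ^ (card T + rk (Y \<union> T) + rk Y))"

text \<open>The cutoff \<open>n\<close> may be any bound on the weights: once a level is empty, all
  further factors are 1.\<close>

definition level_weight :: "'a set \<Rightarrow> ('a \<Rightarrow> nat) \<Rightarrow> nat \<Rightarrow> int" where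
  "level_weight X w n = (\<Prod>k\<le>n. minor_sum (level_set X w (Suc k)) (level_set X w k) *
    nullity_sign (level_set X w (Suc k)))"

definition level_coeff :: "'a set \<Rightarrow> nat \<Rightarrow> int" where
  "level_coeff X n = (\<Sum>w\<in>weight_vectors X n. level_weight X w n)"

lemma nullity_sign_empty [simp]: "nullity_sign {} = 1"
  by (simp add: nullity_sign_def)

lemma minor_sum_self [simp]: "minor_sum X X = 1"
  by (simp add: minor_sum_def power_add[symmetric] mult_2[symmetric])

lemma weight_vectors_le:
  assumes "finite X" "w \<in> weight_vectors X n" "e \<in> X"
  shows "w e \<le> n"
  using assms member_le_sum[of e X w] by (auto simp: weight_vectors_def)

text \<open>The rank of the initial matroid is additive over the layers, so the sum over subsets
  factors. The sign splits as well, because \<open>n\<close> is the sum of the sizes and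
  \<open>matroid_wt M w\<close> the sum of the ranks of the level sets from level 1 on.\<close>

lemma initial_matroid_sum_eq_level_weight:
  assumes w: "w \<in> weight_vectors (ground M) n"
  shows "(-1) ^ n * (\<Sum>S\<in>Pow (ground M).
      (-1) ^ (card S + (matroid_rank (initial_matroid M w) S + matroid_wt M w))) =
    level_weight (ground M) w n"
proof -
  interpret weighted_matroid M w n
    by unfold_locales (rule weight_vectors_le[OF finite_ground w])
  define f where "f k T = (-1 :: int) ^ (card T + rk (U (Suc k) \<union> T) + rk (U (Suc k)))" for k T
  have "(\<Sum>S\<in>Pow (ground M). (-1) ^ (card S + matroid_rank (initial_matroid M w) S)) =
    (\<Sum>S\<in>Pow (ground M). \<Prod>k\<le>n. f k (S \<inter> (U k - U (Suc k))))"
  proof (rule sum.cong[OF refl])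
    fix S assume "S \<in> Pow (ground M)"
    then have S: "S \<subseteq> ground M" by simp
    have "card S = (\<Sum>k\<le>n. card (S \<inter> (U k - U (Suc k))))"
      by (rule card_eq_sum_levels[OF finite_ground S weight_le])
    then have "(-1) ^ (card S + matroid_rank (initial_matroid M w) S) =
      (\<Prod>k\<le>n. (-1 :: int) ^ card (S \<inter> (U k - U (Suc k))) *
         (-1) ^ (rk (U (Suc k) \<union> S \<inter> U k) - rk (U (Suc k))))"
      by (simp add: rank_initial_matroid[OF S] power_add power_sum prod.distrib)
    also have "\<dots> = (\<Prod>k\<le>n. f k (S \<inter> (U k - U (Suc k))))"
    proof (rule prod.cong[OF refl])
      fix k
      have "U (Suc k) \<union> S \<inter> (U k - U (Suc k)) = U (Suc k) \<union> S \<inter> U k"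
        by auto
      then show "(-1 :: int) ^ card (S \<inter> (U k - U (Suc k))) *
         (-1) ^ (rk (U (Suc k) \<union> S \<inter> U k) - rk (U (Suc k))) = f k (S \<inter> (U k - U (Suc k)))"
        using rank_mono[of "U (Suc k)" "U (Suc k) \<union> S \<inter> U k"]
        by (simp add: f_def minus_one_power_diff power_add)
    qed
    finally show "(-1) ^ (card S + matroid_rank (initial_matroid M w) S) =
      (\<Prod>k\<le>n. f k (S \<inter> (U k - U (Suc k))))" .
  qed
  also have "\<dots> = (\<Prod>k\<le>n. minor_sum (U (Suc k)) (U k))"
    using sum_Pow_prod_levels[of U f "Suc n", OF level_set_antimono]
    by (simp add: lessThan_Suc_atMost minor_sum_def f_def)
  finally have *: "(\<Sum>S\<in>Pow (ground M). (-1) ^ (card S + matroid_rank (initial_matroid M w) S)) =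
    (\<Prod>k\<le>n. minor_sum (U (Suc k)) (U k))" .
  have "n = (\<Sum>k<n. card (U (Suc k)))"
    using w sum_eq_sum_levels[OF finite_ground order_refl weight_le, of "\<lambda>e. e"]
    by (simp add: weight_vectors_def Int_absorb1[OF level_set_subset])
  then have "(-1) ^ (n + matroid_wt M w) = (-1 :: int) ^ ((\<Sum>k<n. card (U (Suc k))) + (\<Sum>k<n. rk (U (Suc k))))"
    by (metis wt_eq)
  also have "\<dots> = (\<Prod>k<n. nullity_sign (U (Suc k)))"
    by (simp add: power_add power_sum nullity_sign_def prod.distrib)
  also have "\<dots> = (\<Prod>k\<le>n. nullity_sign (U (Suc k)))"
    by (simp add: lessThan_Suc_atMost[symmetric])
  finally have sign: "(-1) ^ (n + matroid_wt M w) = (\<Prod>k\<le>n. nullity_sign (U (Suc k)))" .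
  have "(-1) ^ n * (\<Sum>S\<in>Pow (ground M).
      (-1) ^ (card S + (matroid_rank (initial_matroid M w) S + matroid_wt M w))) =
    (\<Prod>k\<le>n. nullity_sign (U (Suc k))) *
      (\<Sum>S\<in>Pow (ground M). (-1) ^ (card S + matroid_rank (initial_matroid M w) S))"
    unfolding sign[symmetric] by (simp add: sum_distrib_left power_add ac_simps)
  then show ?thesis
    by (simp add: * level_weight_def prod.distrib mult.commute)
qed

theorem magnitude_coeff_eq: "magnitude_coeff M n = level_coeff (ground M) n"
proof -
  have "laurent_at_minus_one (matroid_charpoly (initial_matroid M w) *
      Poly_Mapping.single (- int (rk (ground M)) - int (matroid_wt M w)) 1) =
    (\<Sum>S\<in>Pow (ground M).
      (-1) ^ (card S + (matroid_rank (initial_matroid M w) S + matroid_wt M w)))"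
    if w: "w \<in> weight_vectors (ground M) n" for w
  proof -
    interpret weighted_matroid M w n
      by unfold_locales (rule weight_vectors_le[OF finite_ground w])
    have [simp]: "ground (initial_matroid M w) = ground M"
      by (simp add: initial_matroid_def)
    \<comment> \<open>The two occurrences of the rank of \<open>M\<close> in the exponent cancel,
      and the absolute value in the evaluation at -1 removes the remaining minus sign.\<close>
    have abs: "nat \<bar>int a - int b - int a - int c\<bar> = b + c" for a b c
      by simp
    show ?thesis
      by (simp add: matroid_charpoly_def sum_distrib_right mult_single laurent_at_minus_one_sum
          laurent_at_minus_one_single rank_initial_matroid_ground power_add)
        (simp add: abs power_add nat_add_distrib ac_simps)
  qed
  then show ?thesis
    using initial_matroid_sum_eq_level_weight
    by (simp add: magnitude_coeff_def magnitude_def motivic_zeta_def level_coeff_def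
        laurent_at_minus_one_sum sum_distrib_left)
qed

lemma level_set_eq_empty:
  assumes "finite X" "w \<in> weight_vectors X n" "n < k"
  shows "level_set X w k = {}"
  using weight_vectors_le[OF assms(1,2)] assms(3) by (fastforce simp: level_set_def)

lemma level_weight_extend:
  assumes "finite X" "w \<in> weight_vectors X n" "n \<le> m"
  shows "level_weight X w m = level_weight X w n"
  unfolding level_weight_def
proof (rule prod.mono_neutral_right)
  show "\<forall>k\<in>{..m} - {..n}. minor_sum (level_set X w (Suc k)) (level_set X w k) *
      nullity_sign (level_set X w (Suc k)) = 1"
    using level_set_eq_empty[OF assms(1,2)] by simp
qed (use assms in auto)

lemma level_coeff_0:
  assumes "finite X"
  shows "level_coeff X 0 = minor_sum {} X"
proof -
  have "weight_vectors X 0 = {\<lambda>_. 0}"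
    using assms by (auto simp: weight_vectors_def fun_eq_iff)
  then show ?thesis
    by (simp add: level_coeff_def level_weight_def level_set_def)
qed

lemma level_weight_Suc:
  assumes "\<And>k. level_set X w (Suc k) = level_set Y v k"
  shows "level_weight X w (Suc n) = minor_sum Y X * nullity_sign Y * level_weight Y v n"
  using assms[of 0] by (simp add: level_weight_def prod.atMost_Suc_shift assms del: prod.atMost_Suc)

text \<open>Split by the support \<open>Y\<close> of \<open>w\<close> and lower \<open>w\<close> by
  one on \<open>Y\<close>: all level sets move down by one index and the total weight drops by
  \<open>card Y\<close>. The summand \<open>Y = X\<close> is present, which later gives the
  denominator belonging to \<open>X\<close>.\<close>

lemma level_coeff_rec:
  assumes "finite X" "n > 0"
  shows "level_coeff X n = (\<Sum>Y | Y \<subseteq> X \<and> Y \<noteq> {} \<and> card Y \<le> n.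
    minor_sum Y X * nullity_sign Y * level_coeff Y (n - card Y))"
proof -
  let ?P = "{Y. Y \<subseteq> X \<and> Y \<noteq> {} \<and> card Y \<le> n}"
  have fin: "finite Y" if "Y \<in> ?P" for Y
    using that assms finite_subset by auto
  have finP: "finite ?P"
    by (rule finite_subset[of _ "Pow X"]) (use assms in auto)
  define up where "up Y v = (\<lambda>e. if e \<in> Y then Suc (v e) else 0)" for Y :: "'a set" and v
  have "level_coeff X n = (\<Sum>w\<in>weight_vectors X n. level_weight X w n)"
    by (simp add: level_coeff_def)
  also have "\<dots> = (\<Sum>(Y, v)\<in>(SIGMA Y:?P. weight_vectors Y (n - card Y)).
      minor_sum Y X * nullity_sign Y * level_weight Y v (n - card Y))"
  proof (rule sum.reindex_bij_witness[of _ "\<lambda>(Y, v). up Y v" "\<lambda>w. ({e \<in> X. 1 \<le> w e}, \<lambda>e. w e - 1)"])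
    fix w assume w: "w \<in> weight_vectors X n"
    let ?Y = "{e \<in> X. 1 \<le> w e}" and ?v = "\<lambda>e. w e - 1"
    show "(case (?Y, ?v) of (Y, v) \<Rightarrow> up Y v) = w"
      using w by (auto simp: up_def weight_vectors_def fun_eq_iff)
    have "n = (\<Sum>e\<in>X. if 1 \<le> w e then 1 + ?v e else 0)"
      using w by (auto simp: weight_vectors_def intro!: sum.cong)
    also have "\<dots> = (\<Sum>e\<in>?Y. 1 + ?v e)"
      by (simp only: sum.inter_filter[OF assms(1)])
    also have "\<dots> = card ?Y + (\<Sum>e\<in>?Y. ?v e)"
      by (simp only: sum.distrib card_eq_sum)
    finally have n: "n = card ?Y + (\<Sum>e\<in>?Y. ?v e)" .
    have "?Y \<noteq> {}"
    proof
      assume "?Y = {}"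
      from n have "n = 0" unfolding \<open>?Y = {}\<close> by simp
      then show False using assms(2) by simp
    qed
    then show mem: "(?Y, ?v) \<in> (SIGMA Y:?P. weight_vectors Y (n - card Y))"
      using w n by (auto simp: weight_vectors_def)
    obtain m where m: "n = Suc m" using assms(2) gr0_implies_Suc by blast
    have "card ?Y > 0" using \<open>?Y \<noteq> {}\<close> assms(1) by (simp add: card_gt_0_iff)
    \<comment> \<open>Peeling off one level leaves the cutoff \<open>n - 1\<close>, while the
      lowered vector has total weight \<open>n - card ?Y\<close>. The two cutoffs give the same
      product, since all levels in between are empty.\<close>
    have "level_weight X w n = minor_sum ?Y X * nullity_sign ?Y * level_weight ?Y ?v m"
      unfolding m by (rule level_weight_Suc) (auto simp: level_set_def)
    also have "level_weight ?Y ?v m = level_weight ?Y ?v (n - card ?Y)"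
      by (rule level_weight_extend) (use mem assms(1) m \<open>card ?Y > 0\<close> in auto)
    finally show "(case (?Y, ?v) of (Y, v) \<Rightarrow>
        minor_sum Y X * nullity_sign Y * level_weight Y v (n - card Y)) = level_weight X w n"
      by simp
  next
    fix p assume "p \<in> (SIGMA Y:?P. weight_vectors Y (n - card Y))"
    then obtain Y v where p: "p = (Y, v)" "Y \<in> ?P" "v \<in> weight_vectors Y (n - card Y)"
      by auto
    show "({e \<in> X. 1 \<le> (case p of (Y, v) \<Rightarrow> up Y v) e}, \<lambda>e. (case p of (Y, v) \<Rightarrow> up Y v) e - 1) = p"
      using p by (auto simp: up_def weight_vectors_def fun_eq_iff)
    have "(\<Sum>e\<in>X. up Y v e) = (\<Sum>e\<in>Y. up Y v e)"
      using p assms(1) by (intro sum.mono_neutral_right) (auto simp: up_def)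
    also have "\<dots> = (\<Sum>e\<in>Y. v e + 1)"
      by (auto simp: up_def intro: sum.cong)
    also have "\<dots> = n"
      using p by (simp add: sum.distrib weight_vectors_def del: add_Suc_right)
    finally show "(case p of (Y, v) \<Rightarrow> up Y v) \<in> weight_vectors X n"
      using p by (auto simp: weight_vectors_def up_def)
  qed
  also have "\<dots> = (\<Sum>Y\<in>?P. \<Sum>v\<in>weight_vectors Y (n - card Y).
      minor_sum Y X * nullity_sign Y * level_weight Y v (n - card Y))"
    by (rule sum.Sigma[symmetric]) (use finP fin finite_weight_vectors in blast)+
  also have "\<dots> = (\<Sum>Y\<in>?P. minor_sum Y X * nullity_sign Y * level_coeff Y (n - card Y))"
    by (simp add: level_coeff_def sum_distrib_left)
  finally show ?thesis .
qed

end

section \<open>Flats and the generating function\<close>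

lemma sum_Pow_cancel:
  fixes f :: "'a set \<Rightarrow> 'b::ab_group_add"
  assumes "e \<in> A" "\<And>S. S \<subseteq> A - {e} \<Longrightarrow> f (insert e S) = - f S"
  shows "(\<Sum>S\<in>Pow A. f S) = 0"
proof -
  have "(\<Sum>S\<in>Pow A. f S) = (\<Sum>S\<in>Pow ((A - {e}) \<union> {e}). f S)"
    using assms(1) by (simp add: insert_absorb)
  also have "\<dots> = (\<Sum>S\<in>Pow (A - {e}). \<Sum>T\<in>Pow {e}. f (S \<union> T))"
    by (rule sum_Pow_union) auto
  also have "\<dots> = 0"
    using assms(2) by (intro sum.neutral) (simp add: Pow_insert)
  finally show ?thesis .
qed

lemma sum_Pow_alternating:
  assumes "finite A" "A \<noteq> {}"
  shows "(\<Sum>S\<in>Pow A. (-1) ^ card S) = (0 :: int)"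
proof -
  obtain e where "e \<in> A" using assms by blast
  then show ?thesis
  proof (rule sum_Pow_cancel)
    fix S assume S: "S \<subseteq> A - {e}"
    then have "finite S" "e \<notin> S" using assms finite_subset by auto
    then show "(-1) ^ card (insert e S) = - ((-1) ^ card S :: int)" by simp
  qed
qed

context matroid
begin

definition flat :: "'a set \<Rightarrow> bool" where
  "flat F \<longleftrightarrow> F \<subseteq> ground M \<and> (\<forall>e\<in>ground M - F. rk F < rk (insert e F))"

definition closure :: "'a set \<Rightarrow> 'a set" where
  "closure X = {e \<in> ground M. rk (insert e X) = rk X}"

lemma flat_subset_ground: "flat F \<Longrightarrow> F \<subseteq> ground M"
  by (simp add: flat_def)

lemma finite_flat: "flat F \<Longrightarrow> finite F"
  using flat_subset_ground finite_ground finite_subset by blast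

lemma finite_flats: "finite {F. flat F \<and> P F}"
  by (rule finite_subset[of _ "Pow (ground M)"]) (use flat_subset_ground finite_ground in auto)

lemma flat_ground [simp]: "flat (ground M)"
  by (simp add: flat_def)

lemma flat_memI: "flat F \<Longrightarrow> X \<subseteq> F \<Longrightarrow> e \<in> ground M \<Longrightarrow> rk (insert e X) = rk X \<Longrightarrow> e \<in> F"
  using rank_insert_eq_mono[of e X F] by (metis DiffI flat_def less_irrefl)

lemma closure_subset_ground: "closure X \<subseteq> ground M"
  by (auto simp: closure_def)

lemma subset_closure: "X \<subseteq> ground M \<Longrightarrow> X \<subseteq> closure X"
  by (auto simp: closure_def insert_absorb)

lemma rank_union_eq:
  assumes "finite T" "\<And>e. e \<in> T \<Longrightarrow> rk (insert e X) = rk X"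
  shows "rk (X \<union> T) = rk X"
  using assms
proof (induction T)
  case (insert e T)
  have "rk (insert e (X \<union> T)) = rk (X \<union> T)"
    by (rule rank_insert_eq_mono[of e X]) (simp_all add: insert.prems)
  then show ?case by (simp add: insert)
qed simp

lemma rank_closure:
  assumes "X \<subseteq> ground M"
  shows "rk (closure X) = rk X"
proof -
  have "finite (closure X)"
    using finite_ground finite_subset closure_subset_ground by blast
  then have "rk (X \<union> closure X) = rk X"
    by (rule rank_union_eq) (simp add: closure_def)
  then show ?thesis
    using subset_closure[OF assms] by (simp add: sup.absorb2)
qed

lemma flat_closure:
  assumes "X \<subseteq> ground M"
  shows "flat (closure X)"
  unfolding flat_def
proof (intro conjI ballI)
  fix e assume e: "e \<in> ground M - closure X"
  then have "rk X \<noteq> rk (insert e X)" by (auto simp: closure_def)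
  then have "rk X < rk (insert e X)"
    using rank_mono[OF subset_insertI, of X e] by linarith
  also have "\<dots> \<le> rk (insert e (closure X))"
    using subset_closure[OF assms] by (intro rank_mono) auto
  finally show "rk (closure X) < rk (insert e (closure X))"
    by (simp add: rank_closure[OF assms])
qed (rule closure_subset_ground)

lemma closure_least: "flat F \<Longrightarrow> X \<subseteq> F \<Longrightarrow> closure X \<subseteq> F"
  using flat_memI by (auto simp: closure_def)

lemma flat_rank_less:
  assumes "flat F" "F \<subset> G" "G \<subseteq> ground M"
  shows "rk F < rk G"
proof -
  obtain e where e: "e \<in> G" "e \<notin> F" using assms by blast
  then have "rk F < rk (insert e F)" using assms by (auto simp: flat_def)
  also have "\<dots> \<le> rk G" using e assms by (intro rank_mono) auto
  finally show ?thesis .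
qed

lemma closure_eqI:
  assumes "flat F" "X \<subseteq> F" "rk X = rk F"
  shows "closure X = F"
proof (rule ccontr)
  have X: "X \<subseteq> ground M" using assms flat_subset_ground by blast
  assume "closure X \<noteq> F"
  then have "closure X \<subset> F" using closure_least[OF assms(1,2)] by blast
  from flat_rank_less[OF flat_closure[OF X] this flat_subset_ground[OF assms(1)]]
  show False using rank_closure[OF X] assms(3) by simp
qed

text \<open>An element of the closure of \<open>Y\<close> outside \<open>Y\<close> is a loop after
  contracting \<open>Y\<close>. Toggling it changes the size of \<open>T\<close> by one but not the
  rank, so the terms cancel in pairs. Flatness of \<open>X\<close> ensures that this element lies in
  \<open>X\<close>.\<close>

lemma minor_sum_nonflat:
  assumes "flat X" "Y \<subseteq> X" "\<not> flat Y"
  shows "minor_sum Y X = 0"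
proof -
  have "Y \<subseteq> ground M" using assms(1,2) flat_subset_ground by blast
  then obtain e where e: "e \<in> ground M - Y" "\<not> rk Y < rk (insert e Y)"
    using assms(3) by (auto simp: flat_def)
  then have eq: "rk (insert e Y) = rk Y"
    using rank_mono[OF subset_insertI, of Y e] by linarith
  have "e \<in> X"
    by (rule flat_memI[OF assms(1,2) _ eq]) (use e in simp)
  with e have "e \<in> X - Y" by simp
  then show ?thesis
    unfolding minor_sum_def
  proof (rule sum_Pow_cancel)
    fix S assume S: "S \<subseteq> X - Y - {e}"
    then have "finite S" "e \<notin> S"
      using finite_flat[OF assms(1)] finite_subset[of S X] by auto
    moreover have "rk (Y \<union> insert e S) = rk (Y \<union> S)"
      using rank_insert_eq_mono[OF eq, of "Y \<union> S"] by simp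
    ultimately show "(-1) ^ (card (insert e S) + rk (Y \<union> insert e S) + rk Y) =
        - ((-1) ^ (card S + rk (Y \<union> S) + rk Y) :: int)"
      by simp
  qed
qed

text \<open>Compared with the alternating sum over all \<open>T\<close>, which vanishes, only the
  terms with \<open>rk (Y \<union> T) = Suc (rk Y)\<close> have the opposite sign. Grouped by the
  closure \<open>F\<close> of \<open>Y \<union> T\<close>, they run over the nonempty subsets of
  \<open>F - Y\<close>, whose alternating sum is -1. So each atom of the interval counts 2.\<close>

lemma minor_sum_eq_atoms:
  assumes Y: "flat Y" and X: "flat X" and YX: "Y \<subset> X" and rank: "rk X \<le> rk Y + 2"
  shows "minor_sum Y X = 2 * int (card {F. flat F \<and> Y \<subset> F \<and> F \<subseteq> X \<and> rk F = Suc (rk Y)})"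
proof -
  let ?A = "{F. flat F \<and> Y \<subset> F \<and> F \<subseteq> X \<and> rk F = Suc (rk Y)}"
  let ?R = "{T. T \<subseteq> X - Y \<and> rk (Y \<union> T) = Suc (rk Y)}"
  have finX: "finite X" using X by (rule finite_flat)
  have finA: "finite ?A" by (rule finite_flats)
  have finR: "finite ?R" by (rule finite_subset[of _ "Pow X"]) (use finX in auto)
  have "minor_sum Y X = (\<Sum>T\<in>Pow (X - Y). (-1) ^ card T -
      2 * (if rk (Y \<union> T) = Suc (rk Y) then (-1) ^ card T else 0))"
    unfolding minor_sum_def
  proof (rule sum.cong[OF refl])
    fix T assume T: "T \<in> Pow (X - Y)"
    have "rk Y \<le> rk (Y \<union> T)" "rk (Y \<union> T) \<le> rk X"
      using T YX by (auto intro: rank_mono)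
    then have "rk (Y \<union> T) = rk Y \<or> rk (Y \<union> T) = Suc (rk Y) \<or> rk (Y \<union> T) = Suc (Suc (rk Y))"
      using rank by linarith
    then show "(-1) ^ (card T + rk (Y \<union> T) + rk Y) =
        (-1) ^ card T - 2 * (if rk (Y \<union> T) = Suc (rk Y) then (-1) ^ card T else 0 :: int)"
      by (auto simp: power_add uminus_power_if)
  qed
  also have "\<dots> = (\<Sum>T\<in>Pow (X - Y). (-1) ^ card T) -
      2 * (\<Sum>T\<in>Pow (X - Y). if rk (Y \<union> T) = Suc (rk Y) then (-1) ^ card T else 0)"
    by (simp add: sum_subtractf sum_distrib_left)
  also have "(\<Sum>T\<in>Pow (X - Y). (-1) ^ card T) = (0 :: int)"
    by (rule sum_Pow_alternating) (use finX YX in auto)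
  also have "(\<Sum>T\<in>Pow (X - Y). if rk (Y \<union> T) = Suc (rk Y) then (-1) ^ card T else 0) =
      (\<Sum>T\<in>?R. (-1) ^ card T :: int)"
    using finX by (subst sum.inter_filter[symmetric]) (auto simp: Pow_def intro: sum.cong)
  also have "\<dots> = (\<Sum>(F, T)\<in>(SIGMA F:?A. Pow (F - Y) - {{}}). (-1) ^ card T)"
  proof (rule sum.reindex_bij_witness[of _ snd "\<lambda>T. (closure (Y \<union> T), T)"])
    fix T assume T: "T \<in> ?R"
    then have g: "Y \<union> T \<subseteq> X" "Y \<union> T \<subseteq> ground M"
      using YX flat_subset_ground[OF X] by auto
    then show "(closure (Y \<union> T), T) \<in> (SIGMA F:?A. Pow (F - Y) - {{}})"
      using T subset_closure[OF g(2)] flat_closure[OF g(2)] rank_closure[OF g(2)]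
        closure_least[OF X g(1)] by (auto simp: psubset_eq)
  next
    fix p assume "p \<in> (SIGMA F:?A. Pow (F - Y) - {{}})"
    then obtain F T where p: "p = (F, T)" "F \<in> ?A" "T \<subseteq> F - Y" "T \<noteq> {}" by auto
    have sub: "Y \<subset> Y \<union> T" "Y \<union> T \<subseteq> F" using p by auto
    have "rk Y < rk (Y \<union> T)"
      by (rule flat_rank_less[OF Y sub(1)]) (use sub p flat_subset_ground in blast)
    moreover have "rk (Y \<union> T) \<le> rk F" using sub by (intro rank_mono)
    ultimately have r: "rk (Y \<union> T) = Suc (rk Y)" using p by simp
    then show "snd p \<in> ?R" using p by auto
    show "(closure (Y \<union> snd p), snd p) = p"
      using p sub r by (simp add: closure_eqI)
  qed auto
  also have "\<dots> = (\<Sum>F\<in>?A. \<Sum>T\<in>Pow (F - Y) - {{}}. (-1) ^ card T)"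
    by (rule sum.Sigma[symmetric]) (use finA finite_flat in auto)
  also have "\<dots> = (\<Sum>F\<in>?A. -1)"
  proof (rule sum.cong[OF refl])
    fix F assume F: "F \<in> ?A"
    then have "finite F" using finite_flat by blast
    then have "(\<Sum>T\<in>Pow (F - Y) - {{}}. (-1) ^ card T) =
        (\<Sum>T\<in>Pow (F - Y). (-1) ^ card T) - (1 :: int)"
      by (subst sum_diff) auto
    also have "(\<Sum>T\<in>Pow (F - Y). (-1) ^ card T) = (0 :: int)"
      by (rule sum_Pow_alternating) (use F \<open>finite F\<close> in auto)
    finally show "(\<Sum>T\<in>Pow (F - Y) - {{}}. (-1) ^ card T) = (-1 :: int)" by simp
  qed
  finally show ?thesis by simp
qed

lemma minor_sum_cover:
  assumes "flat Y" "flat X" "Y \<subset> X" "rk X = Suc (rk Y)"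
  shows "minor_sum Y X = 2"
proof -
  have "F = X" if "flat F" "F \<subseteq> X" "rk F = Suc (rk Y)" for F
    using that assms flat_rank_less[of F X] flat_subset_ground[of X] by auto
  then have "{F. flat F \<and> Y \<subset> F \<and> F \<subseteq> X \<and> rk F = Suc (rk Y)} = {X}"
    using assms by auto
  then show ?thesis
    using minor_sum_eq_atoms[OF assms(1-3)] assms(4) by simp
qed

section \<open>The generating function and its convergence in the unit disc\<close>

definition level_fps :: "'a set \<Rightarrow> complex fps" where
  "level_fps X = Abs_fps (\<lambda>n. of_int (level_coeff X n))"

lemma level_fps_rec:
  assumes "finite X"
  shows "level_fps X = fps_const (of_int (minor_sum {} X)) +
    (\<Sum>Y | Y \<subseteq> X \<and> Y \<noteq> {}.
      fps_const (of_int (minor_sum Y X * nullity_sign Y)) * (fps_X ^ card Y * level_fps Y))"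
    (is "_ = _ + (\<Sum>Y | ?P Y. ?t Y)")
proof (rule fps_ext)
  fix n
  have finP: "finite {Y. ?P Y}"
    by (rule finite_subset[of _ "Pow X"]) (use assms in auto)
  have nth: "fps_nth (?t Y) n = (if card Y \<le> n then
      of_int (minor_sum Y X * nullity_sign Y * level_coeff Y (n - card Y)) else 0)" for Y
    by (simp add: fps_X_power_mult_nth level_fps_def)
  show "fps_nth (level_fps X) n =
    fps_nth (fps_const (of_int (minor_sum {} X)) + (\<Sum>Y | ?P Y. ?t Y)) n"
  proof (cases "n = 0")
    case True
    have "fps_nth (?t Y) 0 = 0" if "?P Y" for Y
    proof -
      have "card Y > 0" using that assms finite_subset by (auto simp: card_gt_0_iff)
      then show ?thesis by (simp add: fps_X_power_mult_nth)
    qed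
    then have "(\<Sum>Y | ?P Y. fps_nth (?t Y) 0) = 0" by (intro sum.neutral) blast
    then show ?thesis
      unfolding True fps_add_nth fps_sum_nth using assms by (simp add: level_fps_def level_coeff_0)
  next
    case False
    have "of_int (level_coeff X n) = (\<Sum>Y | Y \<in> {Y. ?P Y} \<and> card Y \<le> n.
        of_int (minor_sum Y X * nullity_sign Y * level_coeff Y (n - card Y)) :: complex)"
      using False assms by (simp add: level_coeff_rec conj_assoc)
    also have "\<dots> = (\<Sum>Y | ?P Y. fps_nth (?t Y) n)"
      unfolding nth by (rule sum.inter_filter[OF finP])
    finally show ?thesis
      using False by (simp add: fps_sum_nth level_fps_def)
  qed
qed

end

text \<open>The inverse is written down as an explicit geometric series so that its radius of
  convergence can be read off from its coefficients, which have norm 0 or 1.\<close>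

lemma geometric_fps_inverse:
  fixes c :: complex
  assumes "m > 0" "norm c = 1"
  obtains G where "(1 - fps_const c * fps_X ^ m) * G = 1" "1 \<le> fps_conv_radius G"
proof
  define G where "G = Abs_fps (\<lambda>n. if m dvd n then c ^ (n div m) else 0)"
  show "(1 - fps_const c * fps_X ^ m) * G = 1"
  proof (rule fps_ext)
    fix n
    have "fps_nth ((1 - fps_const c * fps_X ^ m) * G) n =
        fps_nth G n - c * (if n < m then 0 else fps_nth G (n - m))"
      by (simp add: ring_distribs mult.assoc fps_X_power_mult_nth)
    also have "\<dots> = fps_nth 1 n"
    proof (cases "n < m")
      case True
      then show ?thesis using assms by (auto simp: G_def dest: nat_dvd_not_less)
    next
      case False
      then have "m dvd n \<longleftrightarrow> m dvd (n - m)" by (simp add: dvd_minus_self)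
      then show ?thesis
        using False assms by (auto simp: G_def le_div_geq)
    qed
    finally show "fps_nth ((1 - fps_const c * fps_X ^ m) * G) n = fps_nth 1 n" .
  qed
  show "1 \<le> fps_conv_radius G"
    unfolding fps_conv_radius_def
  proof (rule conv_radius_geI_ex')
    fix r :: real assume r: "0 < r" "ereal r < 1"
    show "summable (\<lambda>n. fps_nth G n * of_real r ^ n)"
    proof (rule summable_comparison_test')
      show "summable (\<lambda>n. r ^ n)" using r by (intro summable_geometric) auto
      show "norm (fps_nth G n * of_real r ^ n) \<le> r ^ n" for n
        using r assms by (simp add: G_def norm_mult norm_power)
    qed
  qed
qed

lemma fps_conv_radius_sum_ge:
  assumes "\<And>x. x \<in> A \<Longrightarrow> R \<le> fps_conv_radius (f x)"
  shows "R \<le> fps_conv_radius (\<Sum>x\<in>A. f x :: complex fps)"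
  using assms
proof (induction A rule: infinite_finite_induct)
  case (insert x A)
  then show ?case
    using fps_conv_radius_add[of "f x" "\<Sum>x\<in>A. f x"] by (auto intro: order_trans[rotated])
qed auto

lemma fps_conv_radius_mult_ge:
  "R \<le> fps_conv_radius f \<Longrightarrow> R \<le> fps_conv_radius g \<Longrightarrow> R \<le> fps_conv_radius (f * g :: complex fps)"
  using fps_conv_radius_mult[of f g] by (auto intro: order_trans[rotated])

lemma eval_fps_sum:
  fixes f :: "'b \<Rightarrow> complex fps"
  assumes "\<And>x. x \<in> A \<Longrightarrow> R \<le> fps_conv_radius (f x)" "norm z < R"
  shows "eval_fps (\<Sum>x\<in>A. f x) z = (\<Sum>x\<in>A. eval_fps (f x) z)"
  using assms(1)
proof (induction A rule: infinite_finite_induct)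
  case (insert x A)
  have "norm z < fps_conv_radius (f x)"
    using assms(2) insert.prems[of x] by (meson insertI1 less_ereal.simps(1) order.strict_trans2)
  moreover have "R \<le> fps_conv_radius (\<Sum>x\<in>A. f x)"
    using insert.prems by (intro fps_conv_radius_sum_ge) auto
  then have "norm z < fps_conv_radius (\<Sum>x\<in>A. f x)"
    using assms(2) by (meson less_ereal.simps(1) order.strict_trans2)
  ultimately show ?case
    using insert by (simp add: eval_fps_add)
qed auto

context matroid
begin

lemma norm_nullity_sign: "norm (of_int (nullity_sign X) :: complex) = 1"
  by (simp add: nullity_sign_def norm_power)

text \<open>With the summand of \<open>X\<close> moved to the left, the recursion expresses
  \<open>1 - fps_const ?c * fps_X ^ card X\<close> times the series by series of proper subsets.
  Radius 1 is enough, as the poles on the unit circle are only approached radially from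
  inside.\<close>

lemma level_fps_radius:
  assumes "finite X"
  shows "1 \<le> fps_conv_radius (level_fps X)"
  using assms
proof (induction X rule: finite_psubset_induct)
  case (psubset X)
  let ?t = "\<lambda>Y. fps_const (of_int (minor_sum Y X * nullity_sign Y)) * (fps_X ^ card Y * level_fps Y)"
  let ?H = "fps_const (of_int (minor_sum {} X)) + (\<Sum>Y | Y \<subset> X \<and> Y \<noteq> {}. ?t Y)"
  have "1 \<le> fps_conv_radius (?t Y)" if "Y \<subset> X" for Y
    using psubset.IH[OF that] by (intro fps_conv_radius_mult_ge) auto
  then have "1 \<le> fps_conv_radius (\<Sum>Y | Y \<subset> X \<and> Y \<noteq> {}. ?t Y)"
    by (intro fps_conv_radius_sum_ge) auto
  then have H: "1 \<le> fps_conv_radius ?H"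
    using fps_conv_radius_add[of "fps_const (of_int (minor_sum {} X))"] by (auto intro: order_trans[rotated])
  show ?case
  proof (cases "X = {}")
    case True
    then show ?thesis using H level_fps_rec[of X] psubset.hyps by simp
  next
    case False
    let ?c = "of_int (nullity_sign X) :: complex"
    have fin: "finite {Y. Y \<subset> X \<and> Y \<noteq> {}}"
      by (rule finite_subset[of _ "Pow X"]) (use psubset.hyps in auto)
    have "{Y. Y \<subseteq> X \<and> Y \<noteq> {}} = insert X {Y. Y \<subset> X \<and> Y \<noteq> {}}"
      using False by auto
    then have "level_fps X = ?H + fps_const ?c * (fps_X ^ card X * level_fps X)"
      using level_fps_rec[OF psubset.hyps] fin by (simp add: ac_simps)
    then have eq: "(1 - fps_const ?c * fps_X ^ card X) * level_fps X = ?H"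
      by (simp add: algebra_simps)
    have "card X > 0" using False psubset.hyps by (simp add: card_gt_0_iff)
    then obtain G where G: "(1 - fps_const ?c * fps_X ^ card X) * G = 1" "1 \<le> fps_conv_radius G"
      using geometric_fps_inverse[OF _ norm_nullity_sign] by blast
    have "L = G * (D * L)" if "D * G = 1" for D L :: "complex fps"
      using that by (metis mult.assoc mult.commute mult_1)
    from this[OF G(1)]
    have "level_fps X = G * ((1 - fps_const ?c * fps_X ^ card X) * level_fps X)" .
    also have "\<dots> = ?H * G"
      unfolding eq by (rule mult.commute)
    finally show ?thesis using fps_conv_radius_mult_ge[OF H G(2)] by simp
  qed
qed

definition level_fun :: "'a set \<Rightarrow> complex \<Rightarrow> complex" where
  "level_fun X t = eval_fps (level_fps X) t"

lemma level_fun_sums: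
  assumes "finite X" "norm t < 1"
  shows "(\<lambda>n. of_int (level_coeff X n) * t ^ n) sums level_fun X t"
proof -
  have "norm t < fps_conv_radius (level_fps X)"
    using assms level_fps_radius[OF assms(1)] by (meson ereal_less(3) order.strict_trans2)
  from sums_eval_fps[OF this] show ?thesis
    by (simp add: level_fun_def level_fps_def)
qed

text \<open>The denominators are \<open>1 - flat_factor X t\<close>. At a point \<open>u\<close> of
  the unit circle, a nonempty flat adds to the order of the pole exactly if its factor at
  \<open>u\<close> is 1.\<close>

definition flat_factor :: "'a set \<Rightarrow> complex \<Rightarrow> complex" where
  "flat_factor X t = of_int (nullity_sign X) * t ^ card X"

lemma level_fun_rec:
  assumes "finite X" "norm t < 1"
  shows "level_fun X t = of_int (minor_sum {} X) +
    (\<Sum>Y | Y \<subseteq> X \<and> Y \<noteq> {}. of_int (minor_sum Y X) * flat_factor Y t * level_fun Y t)"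
proof -
  let ?t = "\<lambda>Y. fps_const (of_int (minor_sum Y X * nullity_sign Y)) * (fps_X ^ card Y * level_fps Y)"
  have t: "norm t < ereal 1" using assms by simp
  have rad: "norm t < fps_conv_radius f" if "1 \<le> fps_conv_radius f" for f :: "complex fps"
    using that t unfolding one_ereal_def by (rule order.strict_trans2[rotated])
  have r: "1 \<le> fps_conv_radius (level_fps Y)" if "Y \<subseteq> X" for Y
    using that assms finite_subset level_fps_radius by blast
  have s: "1 \<le> fps_conv_radius (?t Y)" if "Y \<subseteq> X" for Y
    using r[OF that] by (intro fps_conv_radius_mult_ge) auto
  have "eval_fps (?t Y) t = of_int (minor_sum Y X) * flat_factor Y t * level_fun Y t"
    if "Y \<subseteq> X" for Y
    using rad[OF r[OF that]] rad[OF fps_conv_radius_mult_ge[of 1 "fps_X ^ card Y" "level_fps Y"]] r[OF that]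
    by (simp add: eval_fps_mult flat_factor_def level_fun_def)
  moreover have "1 \<le> fps_conv_radius (\<Sum>Y | Y \<subseteq> X \<and> Y \<noteq> {}. ?t Y)"
    using s by (intro fps_conv_radius_sum_ge) auto
  then have "eval_fps (level_fps X) t =
      of_int (minor_sum {} X) + eval_fps (\<Sum>Y | Y \<subseteq> X \<and> Y \<noteq> {}. ?t Y) t"
    by (subst level_fps_rec[OF assms(1)]) (simp add: eval_fps_add rad)
  moreover have "eval_fps (\<Sum>Y | Y \<subseteq> X \<and> Y \<noteq> {}. ?t Y) t = (\<Sum>Y | Y \<subseteq> X \<and> Y \<noteq> {}. eval_fps (?t Y) t)"
    using s t by (intro eval_fps_sum[of _ 1]) (auto simp: one_ereal_def)
  ultimately show ?thesis by (simp add: level_fun_def)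
qed

lemma level_fun_empty [simp]: "norm t < 1 \<Longrightarrow> level_fun {} t = 1"
  by (subst level_fun_rec) auto

lemma flat_factor_empty [simp]: "flat_factor {} t = 1"
  by (simp add: flat_factor_def)

text \<open>Non-flats drop out by \<open>minor_sum_nonflat\<close>. As the empty set is a flat with
  factor and function equal to 1, the constant term of the recursion becomes the summand of
  \<open>{}\<close>.\<close>

lemma level_fun_flat_rec:
  assumes "flat {}" "flat F" "F \<noteq> {}" "norm t < 1"
  shows "(1 - flat_factor F t) * level_fun F t =
    (\<Sum>G | flat G \<and> G \<subset> F. of_int (minor_sum G F) * flat_factor G t * level_fun G t)"
proof -
  let ?f = "\<lambda>G. of_int (minor_sum G F) * flat_factor G t * level_fun G t"
  have fin: "finite {G. G \<subset> F \<and> G \<noteq> {}}"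
    by (rule finite_subset[of _ "Pow F"]) (use finite_flat[OF assms(2)] in auto)
  have "{G. G \<subseteq> F \<and> G \<noteq> {}} = insert F {G. G \<subset> F \<and> G \<noteq> {}}"
    using assms by auto
  then have "level_fun F t = ?f {} + (\<Sum>G | G \<subset> F \<and> G \<noteq> {}. ?f G) + flat_factor F t * level_fun F t"
    using level_fun_rec[OF finite_flat[OF assms(2)] assms(4)] fin assms(4) by (simp add: ac_simps)
  moreover have "(\<Sum>G | G \<subset> F \<and> G \<noteq> {}. ?f G) = (\<Sum>G | flat G \<and> G \<subset> F \<and> G \<noteq> {}. ?f G)"
    using fin minor_sum_nonflat[OF assms(2)] by (intro sum.mono_neutral_right) auto
  moreover have "{G. flat G \<and> G \<subset> F} = insert {} {G. flat G \<and> G \<subset> F \<and> G \<noteq> {}}"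
    using assms by auto
  ultimately show ?thesis
    using finite_flats by (simp add: algebra_simps)
qed

section \<open>Poles at 1\<close>

lemma flat_factor_mult: "flat_factor F (u * t) = flat_factor F u * t ^ card F"
  by (simp add: flat_factor_def power_mult_distrib)

lemma flat_factor_1: "flat_factor F 1 = of_int (nullity_sign F)"
  by (simp add: flat_factor_def)

lemma nullity_sign_cases: "nullity_sign F = 1 \<or> nullity_sign F = -1"
  by (simp add: nullity_sign_def uminus_power_if)

text \<open>\<^term>\<open>d\<close> bounds the orders \<^term>\<open>p G\<close> of the poles at \<^term>\<open>u\<close>, and \<^term>\<open>l G\<close> are
  the leading coefficients.\<close>

lemma tendsto_level_fun_rec:
  fixes u :: complex
  assumes "flat {}" "flat F" "F \<noteq> {}" "norm u = 1"
    and ord: "\<And>G. flat G \<Longrightarrow> G \<subset> F \<Longrightarrow> p G \<le> d"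
    and lim: "\<And>G. flat G \<Longrightarrow> G \<subset> F \<Longrightarrow>
      ((\<lambda>r. of_real (1 - r) ^ p G * level_fun G (u * of_real r)) \<longlongrightarrow> l G) (at_left 1)"
  shows "((\<lambda>r. of_real (1 - r) ^ d *
        ((1 - flat_factor F (u * of_real r)) * level_fun F (u * of_real r))) \<longlongrightarrow>
      (\<Sum>G | flat G \<and> G \<subset> F \<and> p G = d. of_int (minor_sum G F) * flat_factor G u * l G)) (at_left 1)"
proof -
  let ?P = "\<lambda>G. flat G \<and> G \<subset> F"
  let ?c = "\<lambda>G. of_int (minor_sum G F) * flat_factor G u :: complex"
  let ?t = "\<lambda>G r. ?c G * of_real r ^ card G * (of_real (1 - r) ^ (d - p G) *
    (of_real (1 - r) ^ p G * level_fun G (u * of_real r)))"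
  have "((\<lambda>r. \<Sum>G | ?P G. ?t G r) \<longlongrightarrow> (\<Sum>G | ?P G. if p G = d then ?c G * l G else 0)) (at_left 1)"
  proof (rule tendsto_sum)
    fix G assume "G \<in> {G. ?P G}"
    then have G: "flat G" "G \<subset> F" by auto
    have "((\<lambda>r::real. of_real (1 - r) ^ (d - p G)) \<longlongrightarrow> (of_real (1 - 1) ^ (d - p G) :: complex)) (at_left 1)"
      by (intro tendsto_intros)
    moreover have "of_real (1 - 1) ^ (d - p G) = (if p G = d then 1 else 0 :: complex)"
      using ord[OF G] by (auto simp: power_0_left)
    ultimately have ord: "((\<lambda>r::real. of_real (1 - r) ^ (d - p G)) \<longlongrightarrow> (if p G = d then 1 else 0 :: complex)) (at_left 1)"
      by simp
    have "((\<lambda>r::real. ?c G * of_real r ^ card G) \<longlongrightarrow> ?c G * of_real 1 ^ card G) (at_left 1)"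
      by (intro tendsto_intros)
    from tendsto_mult[OF this tendsto_mult[OF ord lim[OF G]]]
    have "((\<lambda>r. ?t G r) \<longlongrightarrow> ?c G * of_real 1 ^ card G * ((if p G = d then 1 else 0) * l G)) (at_left 1)"
      .
    then show "((\<lambda>r. ?t G r) \<longlongrightarrow> (if p G = d then ?c G * l G else 0)) (at_left 1)"
      by (cases "p G = d") auto
  qed
  moreover have "(\<Sum>G | ?P G. if p G = d then ?c G * l G else 0) =
      (\<Sum>G | flat G \<and> G \<subset> F \<and> p G = d. ?c G * l G)"
    using finite_flats by (simp add: sum.inter_filter[symmetric] conj_assoc)
  moreover have "\<forall>\<^sub>F r in at_left 1. (\<Sum>G | ?P G. ?t G r) = of_real (1 - r) ^ d *
      ((1 - flat_factor F (u * of_real r)) * level_fun F (u * of_real r))"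
  proof (rule eventually_at_leftI[of 0])
    fix r :: real assume r: "r \<in> {0<..<1}"
    have n: "norm (u * of_real r) < 1" using r assms(4) by (simp add: norm_mult)
    have "?t G r = of_real (1 - r) ^ d *
        (of_int (minor_sum G F) * flat_factor G (u * of_real r) * level_fun G (u * of_real r))"
      if G: "flat G" "G \<subset> F" for G
    proof -
      have "of_real (1 - r) ^ d = (of_real (1 - r) ^ (d - p G) * of_real (1 - r) ^ p G :: complex)"
        using ord[OF G] by (simp flip: power_add)
      then show ?thesis by (simp only: flat_factor_mult mult_ac)
    qed
    then show "(\<Sum>G | ?P G. ?t G r) = of_real (1 - r) ^ d *
      ((1 - flat_factor F (u * of_real r)) * level_fun F (u * of_real r))"
      unfolding level_fun_flat_rec[OF assms(1-3) n] sum_distrib_left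
      by (intro sum.cong) auto
  qed simp
  ultimately show ?thesis
    using Lim_transform_eventually by fastforce
qed

text \<open>The denominator is \<open>1 - r ^ card F\<close>, that is \<open>1 - r\<close> times a
  geometric sum tending to \<open>card F\<close>. So the order rises by one and the leading
  coefficient is divided by \<open>card F\<close>.\<close>

lemma tendsto_level_fun_pole:
  assumes "flat F" "F \<noteq> {}" "flat_factor F u = 1"
    and lim: "((\<lambda>r. of_real (1 - r) ^ d *
      ((1 - flat_factor F (u * of_real r)) * level_fun F (u * of_real r))) \<longlongrightarrow> c) (at_left 1)"
  shows "((\<lambda>r. of_real (1 - r) ^ Suc d * level_fun F (u * of_real r)) \<longlongrightarrow> c / of_nat (card F)) (at_left 1)"
proof -
  let ?S = "\<lambda>r::real. \<Sum>i<card F. of_real r ^ i :: complex"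
  have card: "card F > 0" using assms finite_flat by (simp add: card_gt_0_iff)
  have "(?S \<longlongrightarrow> (\<Sum>i<card F. of_real 1 ^ i)) (at_left 1)"
    by (intro tendsto_intros)
  then have S: "(?S \<longlongrightarrow> of_nat (card F)) (at_left 1)" by simp
  have "((\<lambda>r. of_real (1 - r) ^ d *
      ((1 - flat_factor F (u * of_real r)) * level_fun F (u * of_real r)) / ?S r) \<longlongrightarrow>
      c / of_nat (card F)) (at_left 1)"
    using card by (intro tendsto_divide lim S) auto
  moreover have "\<forall>\<^sub>F r in at_left 1. of_real (1 - r) ^ d *
      ((1 - flat_factor F (u * of_real r)) * level_fun F (u * of_real r)) / ?S r =
      of_real (1 - r) ^ Suc d * level_fun F (u * of_real r)"
  proof (rule eventually_at_leftI[of 0])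
    fix r :: real assume r: "r \<in> {0<..<1}"
    have S: "?S r = of_real (\<Sum>i<card F. r ^ i)" by simp
    have "(\<Sum>i<card F. r ^ i) > 0"
      using r card by (intro sum_pos) auto
    then have "?S r \<noteq> 0" unfolding S of_real_eq_0_iff by simp
    moreover have "1 - flat_factor F (u * of_real r) = of_real (1 - r) * ?S r"
      using assms(3) by (simp add: flat_factor_mult one_diff_power_eq)
    ultimately show "of_real (1 - r) ^ d *
      ((1 - flat_factor F (u * of_real r)) * level_fun F (u * of_real r)) / ?S r =
      of_real (1 - r) ^ Suc d * level_fun F (u * of_real r)"
      by (simp only: power_Suc) (simp add: field_simps)
  qed simp
  ultimately show ?thesis
    by (rule Lim_transform_eventually)
qed

lemma tendsto_level_fun_no_pole:
  assumes "flat_factor F u \<noteq> 1"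
    and lim: "((\<lambda>r. of_real (1 - r) ^ d *
      ((1 - flat_factor F (u * of_real r)) * level_fun F (u * of_real r))) \<longlongrightarrow> c) (at_left 1)"
  shows "((\<lambda>r. of_real (1 - r) ^ d * level_fun F (u * of_real r)) \<longlongrightarrow> c / (1 - flat_factor F u)) (at_left 1)"
proof -
  let ?D = "\<lambda>r::real. 1 - flat_factor F (u * of_real r)"
  have "((\<lambda>r::real. 1 - flat_factor F u * of_real r ^ card F) \<longlongrightarrow>
      1 - flat_factor F u * of_real 1 ^ card F) (at_left 1)"
    by (intro tendsto_intros)
  then have D: "(?D \<longlongrightarrow> 1 - flat_factor F u) (at_left 1)"
    by (simp add: flat_factor_mult)
  have ne: "1 - flat_factor F u \<noteq> 0" using assms(1) by simp
  have "((\<lambda>r. of_real (1 - r) ^ d * (?D r * level_fun F (u * of_real r)) / ?D r) \<longlongrightarrow>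
      c / (1 - flat_factor F u)) (at_left 1)"
    by (intro tendsto_divide lim D ne)
  moreover have "\<forall>\<^sub>F r in at_left 1. of_real (1 - r) ^ d * (?D r * level_fun F (u * of_real r)) / ?D r =
      of_real (1 - r) ^ d * level_fun F (u * of_real r)"
    using tendsto_imp_eventually_ne[OF D ne] by eventually_elim simp
  ultimately show ?thesis
    by (rule Lim_transform_eventually)
qed

lemma tendsto_raise_order:
  assumes "((\<lambda>r. of_real (1 - r) ^ d * f r) \<longlongrightarrow> (c :: complex)) (at_left (1 :: real))"
  shows "((\<lambda>r. of_real (1 - r) ^ Suc d * f r) \<longlongrightarrow> 0) (at_left 1)"
proof -
  have "((\<lambda>r::real. of_real (1 - r)) \<longlongrightarrow> (of_real (1 - 1) :: complex)) (at_left 1)"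
    by (intro tendsto_intros)
  from tendsto_mult[OF this assms] show ?thesis by (simp add: mult.assoc)
qed

text \<open>A complete flag is recorded through its top flat only, to match the recursion for the
  limits, which goes down from flat to flat.\<close>

inductive even_flag :: "'a set \<Rightarrow> bool" where
  even_flag_empty: "even_flag {}"
| even_flag_step: "even_flag G \<Longrightarrow> flat F \<Longrightarrow> G \<subset> F \<Longrightarrow> rk F = Suc (rk G) \<Longrightarrow>
    nullity_sign F = 1 \<Longrightarrow> even_flag F"

lemma even_flag_sign: "even_flag F \<Longrightarrow> nullity_sign F = 1"
  by (induction rule: even_flag.induct) auto

lemma flat_rank_Suc:
  assumes "flat {}" "flat F" "F \<noteq> {}"
  obtains k where "rk F = Suc k"
  using flat_rank_less[OF assms(1), of F] assms flat_subset_ground[of F]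
  by (metis gr0_implies_Suc psubsetI empty_subsetI rank_empty)

lemma flat_psubset_rank_le: "flat G \<Longrightarrow> G \<subset> F \<Longrightarrow> flat F \<Longrightarrow> rk F = Suc k \<Longrightarrow> rk G \<le> k"
  using flat_rank_less[of G F] flat_subset_ground[of F] by auto

text \<open>Order \<open>rk F\<close> needs a pole at each rank, so only the flats of rank
  \<open>k\<close> below \<open>F\<close> count, each with \<open>minor_sum\<close> equal to 2. A
  nonzero coefficient at \<open>G\<close> forces an even flag and hence sign 1, so all contributions
  are nonnegative.\<close>

lemma leading_coeff_1:
  assumes "flat {}" "flat F"
  shows "\<exists>l::real. 0 \<le> l \<and> (l \<noteq> 0 \<longrightarrow> even_flag F) \<and>
    ((\<lambda>r. of_real (1 - r) ^ rk F * level_fun F (of_real r)) \<longlongrightarrow> of_real l) (at_left 1)"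
  using finite_flat[OF assms(2)] assms(2)
proof (induction F rule: finite_psubset_induct)
  case (psubset F)
  show ?case
  proof (cases "F = {}")
    case True
    have "\<forall>\<^sub>F r in at_left 1. level_fun {} (of_real r) = 1"
      by (rule eventually_at_leftI[of 0]) auto
    then have "((\<lambda>r. level_fun {} (of_real r)) \<longlongrightarrow> 1) (at_left 1)"
      by (rule tendsto_eventually)
    then show ?thesis
      using True even_flag_empty by (intro exI[of _ 1]) simp
  next
    case False
    obtain k where k: "rk F = Suc k"
      using flat_rank_Suc[OF assms(1) psubset.prems False] .
    have "\<forall>G. \<exists>l::real. flat G \<and> G \<subset> F \<longrightarrow> 0 \<le> l \<and> (l \<noteq> 0 \<longrightarrow> even_flag G) \<and>
        ((\<lambda>r. of_real (1 - r) ^ rk G * level_fun G (of_real r)) \<longlongrightarrow> of_real l) (at_left 1)"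
      using psubset.IH by blast
    then obtain l :: "'a set \<Rightarrow> real" where "\<forall>G. flat G \<and> G \<subset> F \<longrightarrow> 0 \<le> l G \<and> (l G \<noteq> 0 \<longrightarrow> even_flag G) \<and>
        ((\<lambda>r. of_real (1 - r) ^ rk G * level_fun G (of_real r)) \<longlongrightarrow> of_real (l G)) (at_left 1)"
      by (rule choice[THEN exE])
    then have l: "\<And>G. flat G \<Longrightarrow> G \<subset> F \<Longrightarrow> 0 \<le> l G"
      "\<And>G. flat G \<Longrightarrow> G \<subset> F \<Longrightarrow> l G \<noteq> 0 \<Longrightarrow> even_flag G"
      "\<And>G. flat G \<Longrightarrow> G \<subset> F \<Longrightarrow>
        ((\<lambda>r. of_real (1 - r) ^ rk G * level_fun G (of_real r)) \<longlongrightarrow> of_real (l G)) (at_left 1)"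
      by blast+
    let ?c = "\<Sum>G | flat G \<and> G \<subset> F \<and> rk G = k. 2 * l G"
    have "((\<lambda>r. of_real (1 - r) ^ k *
        ((1 - flat_factor F (1 * of_real r)) * level_fun F (1 * of_real r))) \<longlongrightarrow>
        (\<Sum>G | flat G \<and> G \<subset> F \<and> rk G = k. of_int (minor_sum G F) * flat_factor G 1 * of_real (l G))) (at_left 1)"
      using l(3) flat_psubset_rank_le[OF _ _ psubset.prems k]
      by (intro tendsto_level_fun_rec assms(1) psubset.prems False) auto
    moreover have "(\<Sum>G | flat G \<and> G \<subset> F \<and> rk G = k.
        of_int (minor_sum G F) * flat_factor G 1 * of_real (l G)) = of_real ?c"
      unfolding of_real_sum
    proof (rule sum.cong[OF refl])
      fix G assume G: "G \<in> {G. flat G \<and> G \<subset> F \<and> rk G = k}"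
      then have "minor_sum G F = 2"
        using minor_sum_cover psubset.prems k by auto
      then show "of_int (minor_sum G F) * flat_factor G 1 * of_real (l G) = of_real (2 * l G)"
        using G l(2)[of G] even_flag_sign[of G] by (cases "l G = 0") (auto simp: flat_factor_1)
    qed
    ultimately have lim: "((\<lambda>r. of_real (1 - r) ^ k *
        ((1 - flat_factor F (1 * of_real r)) * level_fun F (1 * of_real r))) \<longlongrightarrow> of_real ?c) (at_left 1)"
      by simp
    show ?thesis
    proof (cases "nullity_sign F = 1")
      case True
      have "((\<lambda>r. of_real (1 - r) ^ Suc k * level_fun F (1 * of_real r)) \<longlongrightarrow>
          of_real ?c / of_nat (card F)) (at_left 1)"
        by (rule tendsto_level_fun_pole[OF psubset.prems False _ lim]) (simp add: True flat_factor_1)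
      then have "((\<lambda>r. of_real (1 - r) ^ rk F * level_fun F (of_real r)) \<longlongrightarrow>
          of_real (?c / real (card F))) (at_left 1)"
        by (simp add: k)
      moreover have "even_flag F" if "?c / real (card F) \<noteq> 0"
      proof -
        have "?c \<noteq> 0" using that by auto
        then obtain G where "G \<in> {G. flat G \<and> G \<subset> F \<and> rk G = k}" "2 * l G \<noteq> 0"
          by (rule sum.not_neutral_contains_not_neutral)
        then show ?thesis
          using l(2)[of G] True k psubset.prems even_flag_step[of G F] by auto
      qed
      moreover have "0 \<le> ?c / real (card F)"
        using l(1) by (intro divide_nonneg_nonneg sum_nonneg) auto
      ultimately show ?thesis by blast
    next
      case False
      then have "flat_factor F 1 \<noteq> 1" by (auto simp: flat_factor_1)
      from tendsto_raise_order[OF tendsto_level_fun_no_pole[OF this lim]]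
      show ?thesis by (intro exI[of _ 0]) (simp add: k)
    qed
  qed
qed

text \<open>An odd flat \<^term>\<open>K\<close> with \<open>H \<subset> K \<subset> F\<close> and \<^term>\<open>rk F = rk H + 2\<close> contributes
  \<open>2 \<sqdot> 2 \<sqdot> (-1) / (1 + 1) = -2\<close> times the leading coefficient of \<^term>\<open>H\<close>, which cancels its share
  of \<^term>\<open>minor_sum H F\<close>, that is twice the number of all such \<^term>\<open>K\<close>.\<close>

lemma no_even_flag_limit_0:
  assumes "flat {}" "flat F" "rk F = Suc (Suc k)"
    "\<And>G. flat G \<Longrightarrow> G \<subset> F \<Longrightarrow> rk G = Suc k \<Longrightarrow> \<not> even_flag G"
  shows "((\<lambda>r. of_real (1 - r) ^ k *
    ((1 - flat_factor F (1 * of_real r)) * level_fun F (1 * of_real r))) \<longlongrightarrow> 0) (at_left 1)"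
  using assms(2-)
proof (induction k arbitrary: F rule: less_induct)
  case (less k F)
  have "\<forall>G. \<exists>l::real. flat G \<longrightarrow> 0 \<le> l \<and> (l \<noteq> 0 \<longrightarrow> even_flag G) \<and>
      ((\<lambda>r. of_real (1 - r) ^ rk G * level_fun G (of_real r)) \<longlongrightarrow> of_real l) (at_left 1)"
    using leading_coeff_1[OF assms(1)] by blast
  then obtain l :: "'a set \<Rightarrow> real" where "\<forall>G. flat G \<longrightarrow> 0 \<le> l G \<and> (l G \<noteq> 0 \<longrightarrow> even_flag G) \<and>
      ((\<lambda>r. of_real (1 - r) ^ rk G * level_fun G (of_real r)) \<longlongrightarrow> of_real (l G)) (at_left 1)"
    by (rule choice[THEN exE])
  then have l: "\<And>G. flat G \<Longrightarrow> l G \<noteq> 0 \<Longrightarrow> even_flag G"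
    "\<And>G. flat G \<Longrightarrow>
      ((\<lambda>r. of_real (1 - r) ^ rk G * level_fun G (of_real r)) \<longlongrightarrow> of_real (l G)) (at_left 1)"
    by blast+
  have l_sign: "flat_factor G 1 * of_real (l G) = of_real (l G)" if "flat G" for G
    using l(1)[OF that] even_flag_sign[of G] by (cases "l G = 0") (auto simp: flat_factor_1)
  have ne: "G \<noteq> {}" if "rk G = Suc j" for G j using that by auto
  \<comment> \<open>Flats of rank \<open>Suc k\<close> would exceed the order \<open>k\<close>. The
    cases below show that they have order at most \<open>k\<close>, so together with the flats of
    rank \<open>k\<close> they make up the terms that survive.\<close>
  define p where "p G = (if rk G = Suc k then k else rk G)" for G
  \<comment> \<open>For an even \<open>G\<close> of rank \<open>Suc k\<close> the induction
    hypothesis gives the limit 0. For an odd one the factor 2 of each cover is cancelled by the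
    denominator \<open>1 - (-1)\<close>, which leaves the plain sum of the
    \<open>l H\<close>.\<close>
  define m where "m G = (if rk G = Suc k then
      if nullity_sign G = 1 then 0 else \<Sum>H | flat H \<and> H \<subset> G \<and> rk H = k. l H else l G)" for G
  have lim: "((\<lambda>r. of_real (1 - r) ^ p G * level_fun G (1 * of_real r)) \<longlongrightarrow> of_real (m G)) (at_left 1)"
    if G: "flat G" "G \<subset> F" for G
  proof (cases "rk G = Suc k")
    case rank: True
    show ?thesis
    proof (cases "nullity_sign G = 1")
      case True
      then have ff: "flat_factor G 1 = 1" by (simp add: flat_factor_1)
      \<comment> \<open>An even flag ending in \<open>H\<close> could be continued by the even flat
        \<open>G\<close>, contrary to the assumption on \<open>F\<close>. For \<open>k = 0\<close>
        this is already absurd, as the empty flat is an even flag.\<close>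
      have nH: "\<not> even_flag H" if "flat H" "H \<subset> G" "rk H = k" for H
        using even_flag_step[of H G] less.prems(3)[OF G rank] that G rank True by auto
      show ?thesis
      proof (cases k)
        case 0
        have "\<not> even_flag {}"
          using nH[of "{}"] assms(1) ne[OF rank] 0 by auto
        with even_flag_empty show ?thesis by blast
      next
        case (Suc k')
        have "((\<lambda>r. of_real (1 - r) ^ k' *
            ((1 - flat_factor G (1 * of_real r)) * level_fun G (1 * of_real r))) \<longlongrightarrow> 0) (at_left 1)"
          by (rule less.IH) (use Suc G rank nH in auto)
        from tendsto_level_fun_pole[OF G(1) ne[OF rank] ff this]
        show ?thesis using True rank Suc by (simp add: p_def m_def)
      qed
    next
      case False
      then have sign: "nullity_sign G = -1" using nullity_sign_cases[of G] by blast
      have "((\<lambda>r. of_real (1 - r) ^ k *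
          ((1 - flat_factor G (1 * of_real r)) * level_fun G (1 * of_real r))) \<longlongrightarrow>
          (\<Sum>H | flat H \<and> H \<subset> G \<and> rk H = k. of_int (minor_sum H G) * flat_factor H 1 * of_real (l H))) (at_left 1)"
        using l(2) flat_psubset_rank_le[OF _ _ G(1) rank]
        by (intro tendsto_level_fun_rec assms(1) G ne[OF rank]) auto
      also have "(\<Sum>H | flat H \<and> H \<subset> G \<and> rk H = k. of_int (minor_sum H G) * flat_factor H 1 * of_real (l H)) =
          (\<Sum>H | flat H \<and> H \<subset> G \<and> rk H = k. 2 * of_real (l H) :: complex)"
        using minor_sum_cover[OF _ G(1)] rank
        by (intro sum.cong) (auto simp: l_sign mult.assoc)
      finally have "((\<lambda>r. of_real (1 - r) ^ k * level_fun G (1 * of_real r)) \<longlongrightarrow>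
          (\<Sum>H | flat H \<and> H \<subset> G \<and> rk H = k. 2 * of_real (l H)) / (1 - flat_factor G 1)) (at_left 1)"
        by (rule tendsto_level_fun_no_pole[rotated]) (simp add: flat_factor_1 sign)
      then show ?thesis
        using rank sign by (simp add: p_def m_def flat_factor_1 sum_distrib_left[symmetric])
    qed
  next
    case False
    then show ?thesis using l(2)[OF G(1)] by (simp add: p_def m_def)
  qed
  have ord: "p G \<le> k" if "flat G" "G \<subset> F" for G
    using flat_psubset_rank_le[OF that less.prems(1,2)] by (auto simp: p_def)
  have "((\<lambda>r. of_real (1 - r) ^ k *
      ((1 - flat_factor F (1 * of_real r)) * level_fun F (1 * of_real r))) \<longlongrightarrow>
      (\<Sum>G | flat G \<and> G \<subset> F \<and> p G = k. of_int (minor_sum G F) * flat_factor G 1 * of_real (m G))) (at_left 1)"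
    by (rule tendsto_level_fun_rec[OF assms(1) less.prems(1) ne[OF less.prems(2)] _ ord lim]) simp_all
  moreover have "(\<Sum>G | flat G \<and> G \<subset> F \<and> p G = k. of_int (minor_sum G F) * flat_factor G 1 * of_real (m G)) =
      (0 :: complex)"
  proof -
    let ?K = "{G. flat G \<and> G \<subset> F \<and> rk G = Suc k}"
    let ?O = "{G. flat G \<and> G \<subset> F \<and> rk G = Suc k \<and> nullity_sign G = -1}"
    let ?H = "{G. flat G \<and> G \<subset> F \<and> rk G = k}"
    let ?g = "\<lambda>G. of_int (minor_sum G F) * flat_factor G 1 * of_real (m G) :: complex"
    have fin: "finite ?K" "finite ?O" "finite ?H" by (rule finite_flats)+
    have "{G. flat G \<and> G \<subset> F \<and> p G = k} = ?K \<union> ?H"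
      by (auto simp: p_def)
    then have "(\<Sum>G | flat G \<and> G \<subset> F \<and> p G = k. ?g G) = (\<Sum>G\<in>?K. ?g G) + (\<Sum>G\<in>?H. ?g G)"
      using fin by (subst sum.union_disjoint[symmetric]) auto
    also have "(\<Sum>G\<in>?K. ?g G) = (\<Sum>G\<in>?O. ?g G)"
      using nullity_sign_cases fin by (intro sum.mono_neutral_right) (auto simp: m_def)
    also have "\<dots> = (\<Sum>G\<in>?O. of_real (- 2 * (\<Sum>H | H \<in> ?H \<and> H \<subset> G. l H)))"
    proof (rule sum.cong[OF refl])
      fix G assume G: "G \<in> ?O"
      then have "{H. flat H \<and> H \<subset> G \<and> rk H = k} = {H. H \<in> ?H \<and> H \<subset> G}"
        by auto
      then show "?g G = of_real (- 2 * (\<Sum>H | H \<in> ?H \<and> H \<subset> G. l H))"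
        using G minor_sum_cover[of G F] less.prems by (simp add: m_def flat_factor_1)
    qed
    also have "\<dots> = of_real (- 2 * (\<Sum>G\<in>?O. \<Sum>H | H \<in> ?H \<and> H \<subset> G. l H))"
      by (simp add: sum_distrib_left del: mult_minus_left)
    also have "(\<Sum>G\<in>?O. \<Sum>H | H \<in> ?H \<and> H \<subset> G. l H) = (\<Sum>H\<in>?H. \<Sum>G | G \<in> ?O \<and> H \<subset> G. l H)"
      using fin by (intro sum.swap_restrict)
    also have "(\<Sum>G\<in>?H. ?g G) = (\<Sum>H\<in>?H. of_real (2 * (\<Sum>G | G \<in> ?O \<and> H \<subset> G. l H)))"
    proof (rule sum.cong[OF refl])
      fix H assume H: "H \<in> ?H"
      have "minor_sum H F = 2 * int (card {G. flat G \<and> H \<subset> G \<and> G \<subseteq> F \<and> rk G = Suc k})"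
        using H less.prems minor_sum_eq_atoms[of H F] by auto
      \<comment> \<open>If \<open>l H\<close> is nonzero, then \<open>H\<close> ends an even flag,
        so every flat of rank \<open>Suc k\<close> between \<open>H\<close> and \<open>F\<close>
        must be odd. Hence the flats counted by \<open>minor_sum H F\<close> are exactly those whose
        contributions have just been regrouped around \<open>H\<close>.\<close>
      moreover have "l H = 0 \<or>
          {G. flat G \<and> H \<subset> G \<and> G \<subseteq> F \<and> rk G = Suc k} = {G. G \<in> ?O \<and> H \<subset> G}"
      proof (cases "l H = 0")
        case False
        then have "even_flag H" using l(1) H by blast
        then have "nullity_sign G = -1" if "flat G" "H \<subset> G" "G \<subset> F" "rk G = Suc k" for G
          using even_flag_step[of H G] less.prems(3)[of G] that H nullity_sign_cases[of G] by auto
        moreover have "G \<noteq> F" if "rk G = Suc k" for G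
          using that less.prems(2) by auto
        ultimately show ?thesis by blast
      qed simp
      moreover have "?g H = of_int (minor_sum H F) * of_real (l H)"
        using H l_sign[of H] by (simp add: m_def mult.assoc)
      ultimately show "?g H = of_real (2 * (\<Sum>G | G \<in> ?O \<and> H \<subset> G. l H))"
        by (elim disjE) (simp_all only: sum_constant, simp_all)
    qed
    finally show ?thesis
      by (simp add: sum_distrib_left sum_negf)
  qed
  ultimately show ?case by simp
qed

section \<open>Poles at the imaginary unit\<close>

text \<open>The counterpart at \<open>\<i>\<close> of an even flag. It starts at rank two because a
  point of a simple matroid has factor \<open>\<i>\<close> and therefore no pole there.\<close>

inductive quarter_flag :: "'a set \<Rightarrow> bool" where
  quarter_flag_base: "flat F \<Longrightarrow> rk F = 2 \<Longrightarrow> flat_factor F \<i> = 1 \<Longrightarrow> quarter_flag F"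
| quarter_flag_step: "quarter_flag G \<Longrightarrow> flat F \<Longrightarrow> G \<subset> F \<Longrightarrow> rk F = Suc (rk G) \<Longrightarrow>
    flat_factor F \<i> = 1 \<Longrightarrow> quarter_flag F"

lemma quarter_flag_props: "quarter_flag F \<Longrightarrow> flat F \<and> flat_factor F \<i> = 1 \<and> 2 \<le> rk F"
  by (induction rule: quarter_flag.induct) auto

lemma simple_indep_pair:
  assumes "matroid_simple M" "e \<in> ground M" "f \<in> ground M"
  shows "{e, f} \<in> indeps M"
  using assms by (cases "e = f") (auto simp: matroid_simple_def matroid_loop_def matroid_parallel_def)

lemma simple_flat_empty:
  assumes "matroid_simple M"
  shows "flat {}"
  using simple_indep_pair[OF assms, of e e for e] by (auto simp: flat_def rank_indep)

lemma flat_rank_0: "flat {} \<Longrightarrow> flat F \<Longrightarrow> rk F = 0 \<Longrightarrow> F = {}"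
  using flat_rank_Suc[of F] by (metis nat.distinct(1))

lemma simple_card_point:
  assumes "matroid_simple M" "flat F" "rk F = 1"
  shows "card F = 1"
proof -
  have "F \<noteq> {}" using assms(3) by auto
  then obtain e where e: "e \<in> F" by blast
  have "f = e" if "f \<in> F" for f
  proof (rule ccontr)
    assume "f \<noteq> e"
    have "{e, f} \<in> indeps M"
      using simple_indep_pair[OF assms(1)] e that flat_subset_ground[OF assms(2)] by blast
    from rank_ge_card[OF this, of F] \<open>f \<noteq> e\<close> e that assms(3) show False by simp
  qed
  with e have "F = {e}" by blast
  then show ?thesis by simp
qed

lemma tendsto_level_fun_empty:
  assumes "norm u = 1"
  shows "((\<lambda>r. level_fun {} (u * of_real r)) \<longlongrightarrow> 1) (at_left 1)"
proof (rule tendsto_eventually)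
  show "\<forall>\<^sub>F r in at_left 1. level_fun {} (u * of_real r) = 1"
    by (rule eventually_at_leftI[of 0]) (use assms in \<open>auto simp: norm_mult\<close>)
qed

lemma tendsto_level_fun_point:
  assumes "matroid_simple M" "flat F" "rk F = 1"
  shows "((\<lambda>r. level_fun F (\<i> * of_real r)) \<longlongrightarrow> 2 / (1 - \<i>)) (at_left 1)"
proof -
  have empty: "flat {}" by (rule simple_flat_empty[OF assms(1)])
  have ne: "F \<noteq> {}" using assms(3) by auto
  have below: "G = {}" if "flat G" "G \<subset> F" for G
    using flat_rank_0[OF empty that(1)] flat_psubset_rank_le[OF that assms(2), of 0] assms(3) by simp
  have ff: "flat_factor F \<i> = \<i>"
    using simple_card_point[OF assms] assms(3) by (simp add: flat_factor_def nullity_sign_def)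
  have "((\<lambda>r. of_real (1 - r) ^ 0 *
      ((1 - flat_factor F (\<i> * of_real r)) * level_fun F (\<i> * of_real r))) \<longlongrightarrow>
      (\<Sum>G | flat G \<and> G \<subset> F \<and> (0::nat) = 0. of_int (minor_sum G F) * flat_factor G \<i> * 1)) (at_left 1)"
    using tendsto_level_fun_empty[of \<i>] below
    by (intro tendsto_level_fun_rec empty assms(2) ne) auto
  moreover have "{G. flat G \<and> G \<subset> F \<and> (0::nat) = 0} = {{}}"
    using below empty ne by auto
  moreover have "minor_sum {} F = 2"
    using minor_sum_cover[OF empty assms(2)] ne assms(3) by auto
  ultimately have "((\<lambda>r. of_real (1 - r) ^ 0 *
      ((1 - flat_factor F (\<i> * of_real r)) * level_fun F (\<i> * of_real r))) \<longlongrightarrow> 2) (at_left 1)"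
    by simp
  from tendsto_level_fun_no_pole[OF _ this] show ?thesis
    by (simp add: ff complex_eq_iff)
qed

text \<open>Here the common phase \<open>\<i>\<close> arises. If the line has n points, the empty
  flat contributes 2n and each point \<open>2 * \<i> * (2 / (1 - \<i>))\<close>, which is
  \<open>-2 + 2 * \<i>\<close>. The real parts cancel and \<open>\<i>\<close> times 2n
  remains.\<close>

lemma leading_coeff_i_line:
  assumes simple: "matroid_simple M" and 0: "flat F" "rk F = Suc (Suc 0)"
  shows "\<exists>l::real. 0 \<le> l \<and> (l \<noteq> 0 \<longrightarrow> flat_factor F \<i> = 1) \<and> (quarter_flag F \<longrightarrow> l > 0) \<and>
    ((\<lambda>r. of_real (1 - r) ^ Suc 0 * level_fun F (\<i> * of_real r)) \<longlongrightarrow> \<i> * of_real l) (at_left 1)"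
proof -
  have empty: "flat {}" by (rule simple_flat_empty[OF simple])
  have ne: "F \<noteq> {}" using 0 by auto
  let ?P = "{G. flat G \<and> {} \<subset> G \<and> G \<subseteq> F \<and> rk G = Suc (rk {})}"
  define l where "l G = (if G = {} then 1 else 2 / (1 - \<i>))" for G :: "'a set"
  have below: "G = {} \<or> rk G = 1" if "flat G" "G \<subset> F" for G
    using flat_rank_0[OF empty that(1)] flat_psubset_rank_le[OF that 0] by linarith
  have ff: "flat_factor G \<i> = \<i>" if "flat G" "rk G = 1" for G
    using simple_card_point[OF simple that] that by (simp add: flat_factor_def nullity_sign_def)
  have pt: "minor_sum {} F = 2 * int (card ?P)"
    using minor_sum_eq_atoms[OF empty 0(1)] ne 0(2) by auto
  have "?P \<noteq> {}"
  proof -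
    obtain e where e: "e \<in> F" using ne by blast
    then have eg: "{e} \<subseteq> ground M" "{e} \<subseteq> F" using flat_subset_ground[OF 0(1)] by auto
    have "{e} \<in> indeps M" using simple_indep_pair[OF simple, of e e] eg by simp
    then have "rk {e} = 1" by (simp add: rank_indep)
    then have "closure {e} \<in> ?P"
      using flat_closure[OF eg(1)] rank_closure[OF eg(1)] subset_closure[OF eg(1)]
        closure_least[OF 0(1) eg(2)] by auto
    then show ?thesis by blast
  qed
  moreover have "finite ?P" by (rule finite_flats)
  ultimately have card: "card ?P > 0" by (simp add: card_gt_0_iff)
  have lim: "((\<lambda>r. of_real (1 - r) ^ 0 *
      ((1 - flat_factor F (\<i> * of_real r)) * level_fun F (\<i> * of_real r))) \<longlongrightarrow>
      (\<Sum>G | flat G \<and> G \<subset> F \<and> (0::nat) = 0. of_int (minor_sum G F) * flat_factor G \<i> * l G)) (at_left 1)"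
  proof (rule tendsto_level_fun_rec[OF empty 0(1) ne])
    fix G assume G: "flat G" "G \<subset> F"
    show "((\<lambda>r. of_real (1 - r) ^ 0 * level_fun G (\<i> * of_real r)) \<longlongrightarrow> l G) (at_left 1)"
      using below[OF G] tendsto_level_fun_empty[of \<i>] tendsto_level_fun_point[OF simple G(1)]
      by (auto simp: l_def)
  qed auto
  have "{G. flat G \<and> G \<subset> F \<and> (0::nat) = 0} = insert {} ?P"
    using below empty ne 0(2) by auto
  then have "(\<Sum>G | flat G \<and> G \<subset> F \<and> (0::nat) = 0. of_int (minor_sum G F) * flat_factor G \<i> * l G) =
      of_int (minor_sum {} F) + (\<Sum>G\<in>?P. of_int (minor_sum G F) * flat_factor G \<i> * l G)"
    using \<open>finite ?P\<close> by (simp add: l_def)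
  also have "(\<Sum>G\<in>?P. of_int (minor_sum G F) * flat_factor G \<i> * l G) =
      (\<Sum>G\<in>?P. 2 * \<i> * (2 / (1 - \<i>)))"
  proof (rule sum.cong[OF refl])
    fix G assume G: "G \<in> ?P"
    then have "G \<subset> F" using 0 by auto
    then have "G \<noteq> F" "minor_sum G F = 2"
      using G 0 minor_sum_cover[of G F] by auto
    then show "of_int (minor_sum G F) * flat_factor G \<i> * l G = 2 * \<i> * (2 / (1 - \<i>))"
      using G ff[of G] by (auto simp: l_def)
  qed
  also have "of_int (minor_sum {} F) + \<dots> = \<i> * of_real (2 * card ?P)"
  proof -
    have *: "2 * \<i> * (2 / (1 - \<i>)) = -2 + 2 * \<i>"
      by (simp add: complex_eq_iff Re_divide Im_divide)
    show ?thesis unfolding pt * sum_constant by (simp add: algebra_simps)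
  qed
  finally have lim': "((\<lambda>r. of_real (1 - r) ^ 0 *
      ((1 - flat_factor F (\<i> * of_real r)) * level_fun F (\<i> * of_real r))) \<longlongrightarrow>
      \<i> * of_real (2 * card ?P)) (at_left 1)"
    using lim by simp
  show ?thesis
  proof (cases "flat_factor F \<i> = 1")
    case True
    from tendsto_level_fun_pole[OF 0(1) ne True lim']
    have "((\<lambda>r. of_real (1 - r) ^ Suc 0 * level_fun F (\<i> * of_real r)) \<longlongrightarrow>
        \<i> * of_real (2 * card ?P / real (card F))) (at_left 1)"
      by simp
    moreover have "2 * card ?P / real (card F) > 0"
      using card ne finite_flat[OF 0(1)] by (simp add: card_gt_0_iff)
    ultimately show ?thesis
      using True by (intro exI[of _ "2 * card ?P / real (card F)"]) auto
  next
    case False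
    from tendsto_raise_order[OF tendsto_level_fun_no_pole[OF False lim']]
    show ?thesis using False quarter_flag_props[of F] by (intro exI[of _ 0]) auto
  qed
qed

text \<open>From lines upward each cover multiplies by 2 and by a factor that is 1 wherever the
  coefficient is nonzero. All contributions thus keep the phase \<open>\<i>\<close> with a
  nonnegative modulus, so none can cancel the positive one coming from a quarter flag.\<close>

lemma leading_coeff_i:
  assumes simple: "matroid_simple M" and "flat F" "rk F = Suc (Suc k)"
  shows "\<exists>l::real. 0 \<le> l \<and> (l \<noteq> 0 \<longrightarrow> flat_factor F \<i> = 1) \<and> (quarter_flag F \<longrightarrow> l > 0) \<and>
    ((\<lambda>r. of_real (1 - r) ^ Suc k * level_fun F (\<i> * of_real r)) \<longlongrightarrow> \<i> * of_real l) (at_left 1)"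
    (is "\<exists>l. ?Q F k l")
  using assms(2,3)
proof (induction k arbitrary: F rule: less_induct)
  case (less k F)
  have empty: "flat {}" by (rule simple_flat_empty[OF simple])
  have ne: "F \<noteq> {}" using less.prems by auto
  show ?case
  proof (cases k)
    case 0
    then show ?thesis using leading_coeff_i_line[OF simple] less.prems by simp
  next
    case (Suc j)
    have rank_le: "rk G \<le> Suc k" if "flat G" "G \<subset> F" for G
      using flat_psubset_rank_le[OF that less.prems] .
    \<comment> \<open>Truncated subtraction gives order 0 both to the empty flat and to points, as
      it should. Since \<open>k\<close> is positive here, order \<open>k\<close> then picks out just
      the flats of rank \<open>Suc k\<close>; for lines it would include the empty flat, hence their
      separate treatment.\<close>
    let ?L = "\<lambda>G m. ((\<lambda>r. of_real (1 - r) ^ (rk G - 1) * level_fun G (\<i> * of_real r)) \<longlongrightarrow> m) (at_left 1)"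
    let ?R = "\<lambda>G l. 0 \<le> l \<and> (l \<noteq> 0 \<longrightarrow> flat_factor G \<i> = 1) \<and> (quarter_flag G \<longrightarrow> 0 < l)"
    have step: "\<exists>l m. ?L G m \<and> (rk G = Suc k \<longrightarrow> m = \<i> * of_real l \<and> ?R G l)"
      if "flat G" "G \<subset> F" for G
    proof -
      have "rk G = 0 \<or> rk G = 1 \<or> (\<exists>i. rk G = Suc (Suc i) \<and> i < k)"
        using rank_le[OF that] by (cases "rk G"; cases "rk G - 1") auto
      then consider "rk G = 0" | "rk G = 1" | i where "rk G = Suc (Suc i)" "i < k"
        by metis
      then show ?thesis
      proof cases
        case 1
        then have "G = {}" by (rule flat_rank_0[OF empty that(1)])
        then show ?thesis using tendsto_level_fun_empty[of \<i>] by auto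
      next
        case 2
        then show ?thesis using tendsto_level_fun_point[OF simple that(1)] Suc by auto
      next
        case 3
        from less.IH[OF 3(2) that(1) 3(1)] obtain l where "?Q G i l" ..
        then show ?thesis using 3(1) by (intro exI[of _ l] exI[of _ "\<i> * of_real l"]) simp
      qed
    qed
    then have "\<forall>G. \<exists>l m. flat G \<and> G \<subset> F \<longrightarrow>
        ?L G m \<and> (rk G = Suc k \<longrightarrow> m = \<i> * of_real l \<and> ?R G l)"
      by blast
    then obtain l where "\<forall>G. \<exists>m. flat G \<and> G \<subset> F \<longrightarrow>
        ?L G m \<and> (rk G = Suc k \<longrightarrow> m = \<i> * of_real (l G) \<and> ?R G (l G))"
      by (rule choice[THEN exE])
    then obtain m where "\<forall>G. flat G \<and> G \<subset> F \<longrightarrow>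
        ?L G (m G) \<and> (rk G = Suc k \<longrightarrow> m G = \<i> * of_real (l G) \<and> ?R G (l G))"
      by (rule choice[THEN exE])
    then have m: "\<And>G. flat G \<Longrightarrow> G \<subset> F \<Longrightarrow> ?L G (m G)"
      and l: "\<And>G. flat G \<Longrightarrow> G \<subset> F \<Longrightarrow> rk G = Suc k \<Longrightarrow> m G = \<i> * of_real (l G) \<and> ?R G (l G)"
      by blast+
    let ?P = "{G. flat G \<and> G \<subset> F \<and> rk G = Suc k}"
    let ?c = "\<Sum>G\<in>?P. 2 * l G"
    have fin: "finite ?P" by (rule finite_flats)
    have "((\<lambda>r. of_real (1 - r) ^ k *
        ((1 - flat_factor F (\<i> * of_real r)) * level_fun F (\<i> * of_real r))) \<longlongrightarrow>
        (\<Sum>G | flat G \<and> G \<subset> F \<and> rk G - 1 = k. of_int (minor_sum G F) * flat_factor G \<i> * m G)) (at_left 1)"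
    proof (rule tendsto_level_fun_rec[OF empty less.prems(1) ne])
      fix G assume G: "flat G" "G \<subset> F"
      show "rk G - 1 \<le> k" using rank_le[OF G] by simp
      show "?L G (m G)" using m[OF G] .
    qed simp
    also have "{G. flat G \<and> G \<subset> F \<and> rk G - 1 = k} = ?P"
      using Suc by auto
    also have "(\<Sum>G\<in>?P. of_int (minor_sum G F) * flat_factor G \<i> * m G) = \<i> * of_real ?c"
      unfolding of_real_sum sum_distrib_left
    proof (rule sum.cong[OF refl])
      fix G assume G: "G \<in> ?P"
      then have "minor_sum G F = 2" using minor_sum_cover[of G F] less.prems by auto
      then show "of_int (minor_sum G F) * flat_factor G \<i> * m G = \<i> * of_real (2 * l G)"
        using G l[of G] by (cases "l G = 0") auto
    qed
    finally have lim: "((\<lambda>r. of_real (1 - r) ^ k *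
        ((1 - flat_factor F (\<i> * of_real r)) * level_fun F (\<i> * of_real r))) \<longlongrightarrow> \<i> * of_real ?c) (at_left 1)" .
    show ?thesis
    proof (cases "flat_factor F \<i> = 1")
      case True
      from tendsto_level_fun_pole[OF less.prems(1) ne True lim]
      have "((\<lambda>r. of_real (1 - r) ^ Suc k * level_fun F (\<i> * of_real r)) \<longlongrightarrow>
          \<i> * of_real (?c / real (card F))) (at_left 1)"
        by simp
      moreover have nonneg: "0 \<le> ?c / real (card F)"
        using l by (intro divide_nonneg_nonneg sum_nonneg) auto
      moreover have "0 < ?c / real (card F)" if "quarter_flag F"
      proof -
        from that obtain G where G: "quarter_flag G" "G \<subset> F" "rk F = Suc (rk G)"
          by cases (use less.prems Suc in auto)
        then have GP: "G \<in> ?P" using quarter_flag_props less.prems by auto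
        have "0 < 2 * l G" using l[of G] GP G by auto
        then have "0 < ?c"
          using l GP fin by (intro sum_pos2[of ?P G]) auto
        then show ?thesis
          using ne finite_flat[OF less.prems(1)] by (simp add: card_gt_0_iff)
      qed
      ultimately show ?thesis using True by blast
    next
      case False
      from tendsto_raise_order[OF tendsto_level_fun_no_pole[OF False lim]]
      show ?thesis using False quarter_flag_props[of F] by (intro exI[of _ 0]) auto
    qed
  qed
qed

text \<open>Both rays are scaled by the same power \<open>(1 - r) ^ Suc k\<close>. The limit at 1 is
  0: the pole of the ground set, of even nullity, raises the order from \<open>k\<close> to
  \<open>Suc k\<close> while the limit before was already 0. The limit at \<open>\<i>\<close> is
  nonzero.\<close>

theorem infinitely_many_negative_coeffs:
  assumes simple: "matroid_simple M" and even: "even (card (ground M) + rk (ground M))"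
    and no_even: "\<not> even_flag (ground M)" and quarter: "quarter_flag (ground M)"
  shows "infinite {n. magnitude_coeff M n < 0}"
proof
  let ?E = "ground M" and ?a = "\<lambda>n. level_coeff (ground M) n"
  let ?S = "{n. ?a n < 0}"
  assume "finite {n. magnitude_coeff M n < 0}"
  then have finS: "finite ?S" by (simp add: magnitude_coeff_eq)
  have empty: "flat {}" by (rule simple_flat_empty[OF simple])
  have sign: "nullity_sign ?E = 1" using even by (simp add: nullity_sign_def)
  have "2 \<le> rk ?E" using quarter_flag_props[OF quarter] by simp
  then obtain k where k: "rk ?E = Suc (Suc k)"
    by (metis One_nat_def Suc_1 Suc_le_D Suc_le_mono)
  have ne: "?E \<noteq> {}" using k by auto
  obtain l :: real where l: "0 < l"
    "((\<lambda>r. of_real (1 - r) ^ Suc k * level_fun ?E (\<i> * of_real r)) \<longlongrightarrow> \<i> * of_real l) (at_left 1)"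
    using leading_coeff_i[OF simple flat_ground k] quarter by blast
  have "\<not> even_flag G" if "flat G" "G \<subset> ?E" "rk G = Suc k" for G
    using even_flag_step[of G ?E] that no_even sign k by auto
  then have "((\<lambda>r. of_real (1 - r) ^ k *
      ((1 - flat_factor ?E (1 * of_real r)) * level_fun ?E (1 * of_real r))) \<longlongrightarrow> 0) (at_left 1)"
    by (rule no_even_flag_limit_0[OF empty flat_ground k])
  from tendsto_level_fun_pole[OF flat_ground ne _ this]
  have lim1: "((\<lambda>r. of_real (1 - r) ^ Suc k * level_fun ?E (of_real r)) \<longlongrightarrow> 0) (at_left 1)"
    by (simp add: flat_factor_1 sign)
  \<comment> \<open>Adding twice the absolute value at the finitely many negative coefficients turns
    each coefficient into its absolute value. As \<open>r ^ n\<close> is at most 1, \<open>C\<close>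
    bounds this correction for all \<open>r\<close>.\<close>
  define C where "C = (\<Sum>n\<in>?S. 2 * \<bar>real_of_int (?a n)\<bar>)"
  have bound: "norm (level_fun ?E (\<i> * of_real r)) \<le> norm (level_fun ?E (of_real r)) + C"
    if r: "0 < r" "r < 1" for r :: real
  proof -
    have "(\<lambda>n. Re (of_int (?a n) * of_real r ^ n)) sums Re (level_fun ?E (of_real r))"
      by (rule sums_Re[OF level_fun_sums[OF finite_ground]]) (use r in simp)
    then have "(\<lambda>n. real_of_int (?a n) * r ^ n) sums Re (level_fun ?E (of_real r))"
      by (simp flip: of_real_power)
    moreover have "(\<lambda>n. if n \<in> ?S then 2 * \<bar>real_of_int (?a n)\<bar> * r ^ n else 0) sums
        (\<Sum>n\<in>?S. 2 * \<bar>real_of_int (?a n)\<bar> * r ^ n)"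
      by (rule sums_If_finite_set[OF finS])
    ultimately have "(\<lambda>n. real_of_int (?a n) * r ^ n +
        (if n \<in> ?S then 2 * \<bar>real_of_int (?a n)\<bar> * r ^ n else 0)) sums
        (Re (level_fun ?E (of_real r)) + (\<Sum>n\<in>?S. 2 * \<bar>real_of_int (?a n)\<bar> * r ^ n))"
      by (rule sums_add)
    moreover have "real_of_int (?a n) * r ^ n +
        (if n \<in> ?S then 2 * \<bar>real_of_int (?a n)\<bar> * r ^ n else 0) = \<bar>real_of_int (?a n)\<bar> * r ^ n" for n
      by (auto simp: algebra_simps)
    ultimately have abs: "(\<lambda>n. \<bar>real_of_int (?a n)\<bar> * r ^ n) sums
        (Re (level_fun ?E (of_real r)) + (\<Sum>n\<in>?S. 2 * \<bar>real_of_int (?a n)\<bar> * r ^ n))"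
      by simp
    have "(\<lambda>n. of_int (?a n) * (\<i> * of_real r) ^ n) sums level_fun ?E (\<i> * of_real r)"
      by (rule level_fun_sums[OF finite_ground]) (use r in \<open>simp add: norm_mult\<close>)
    then have "level_fun ?E (\<i> * of_real r) = suminf (\<lambda>n. of_int (?a n) * (\<i> * of_real r) ^ n)"
      by (simp add: sums_iff)
    also have "norm \<dots> \<le> suminf (\<lambda>n. \<bar>real_of_int (?a n)\<bar> * r ^ n)"
      by (rule norm_suminf_le) (use r abs in \<open>auto simp: norm_mult norm_power sums_iff\<close>)
    also have "\<dots> = Re (level_fun ?E (of_real r)) + (\<Sum>n\<in>?S. 2 * \<bar>real_of_int (?a n)\<bar> * r ^ n)"
      using abs by (simp add: sums_iff)
    also have "\<dots> \<le> norm (level_fun ?E (of_real r)) + C"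
    proof (rule add_mono[OF complex_Re_le_cmod])
      show "(\<Sum>n\<in>?S. 2 * \<bar>real_of_int (?a n)\<bar> * r ^ n) \<le> C"
        unfolding C_def using r by (intro sum_mono mult_left_le) (auto simp: power_le_one)
    qed
    finally show ?thesis .
  qed
  have "((\<lambda>r::real. (1 - r) ^ Suc k * C) \<longlongrightarrow> (1 - 1) ^ Suc k * C) (at_left 1)"
    by (intro tendsto_intros)
  from tendsto_add[OF tendsto_norm[OF lim1] this]
  have upper: "((\<lambda>r. norm (of_real (1 - r) ^ Suc k * level_fun ?E (of_real r)) + (1 - r) ^ Suc k * C)
      \<longlongrightarrow> 0) (at_left 1)"
    by simp
  have "norm (\<i> * of_real l) \<le> 0"
  proof (rule tendsto_le[OF _ upper tendsto_norm[OF l(2)]])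
    show "\<forall>\<^sub>F r in at_left 1. norm (of_real (1 - r) ^ Suc k * level_fun ?E (\<i> * of_real r)) \<le>
        norm (of_real (1 - r) ^ Suc k * level_fun ?E (of_real r)) + (1 - r) ^ Suc k * C"
    proof (rule eventually_at_leftI[of 0])
      fix r :: real assume r: "r \<in> {0<..<1}"
      have n: "norm (of_real (1 - r) ^ Suc k * z) = (1 - r) ^ Suc k * norm z" for z :: complex
        unfolding norm_mult norm_power norm_of_real using r by simp
      have "(1 - r) ^ Suc k * norm (level_fun ?E (\<i> * of_real r)) \<le>
          (1 - r) ^ Suc k * (norm (level_fun ?E (of_real r)) + C)"
        using bound[of r] r by (intro mult_left_mono) auto
      then show "norm (of_real (1 - r) ^ Suc k * level_fun ?E (\<i> * of_real r)) \<le>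
        norm (of_real (1 - r) ^ Suc k * level_fun ?E (of_real r)) + (1 - r) ^ Suc k * C"
        unfolding n by (simp only: distrib_left)
    qed simp
  qed simp
  with l(1) show False by (simp add: norm_mult)
qed

end

section \<open>A tree of lines\<close>

definition independent_family :: "('a \<Rightarrow> 'b::real_vector) \<Rightarrow> 'a set \<Rightarrow> bool" where
  "independent_family v I \<longleftrightarrow> (\<forall>c. (\<Sum>e\<in>I. c e *\<^sub>R v e) = 0 \<longrightarrow> (\<forall>e\<in>I. c e = 0))"

text \<open>Equal vectors at different elements count as dependent, as in
  \<open>real_representable\<close>; hence the injectivity next to the independence of the
  image.\<close>

lemma independent_family_iff:
  assumes "finite I"
  shows "independent_family v I \<longleftrightarrow> inj_on v I \<and> independent (v ` I)"
proof
  assume I: "independent_family v I"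
  have inj: "inj_on v I"
  proof (rule inj_onI, rule ccontr)
    fix e f assume ef: "e \<in> I" "f \<in> I" "v e = v f" "e \<noteq> f"
    define c :: "'a \<Rightarrow> real" where "c x = (if x = e then 1 else if x = f then -1 else 0)" for x
    have "(\<Sum>x\<in>I. c x *\<^sub>R v x) = (\<Sum>x\<in>{e, f}. c x *\<^sub>R v x)"
      using ef assms by (intro sum.mono_neutral_right) (auto simp: c_def)
    also have "\<dots> = 0" using ef by (simp add: c_def)
    finally have "c e = 0" using I ef by (auto simp: independent_family_def)
    then show False by (simp add: c_def)
  qed
  have "u x = 0" if "(\<Sum>x\<in>v ` I. u x *\<^sub>R x) = 0" "x \<in> v ` I" for u x
  proof -
    have "(\<Sum>e\<in>I. u (v e) *\<^sub>R v e) = 0"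
      using that(1) by (simp add: sum.reindex[OF inj])
    then show ?thesis
      using I that(2) unfolding independent_family_def by (auto dest!: spec[of _ "\<lambda>e. u (v e)"])
  qed
  then have "independent (v ` I)"
    using assms by (auto simp: dependent_finite)
  with inj show "inj_on v I \<and> independent (v ` I)" by blast
next
  assume I: "inj_on v I \<and> independent (v ` I)"
  show "independent_family v I"
    unfolding independent_family_def
  proof (intro allI impI ballI)
    fix c e assume c: "(\<Sum>e\<in>I. c e *\<^sub>R v e) = 0" and e: "e \<in> I"
    define u where "u x = c (the_inv_into I v x)" for x
    have u: "u (v f) = c f" if "f \<in> I" for f
      using I that by (simp add: u_def the_inv_into_f_f)
    have "(\<Sum>x\<in>v ` I. u x *\<^sub>R x) = (\<Sum>e\<in>I. c e *\<^sub>R v e)"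
      using I u by (simp add: sum.reindex)
    then have "(\<Sum>x\<in>v ` I. u x *\<^sub>R x) = 0" using c by simp
    then have "u (v e) = 0"
      using I e assms dependent_finite[of "v ` I"] by blast
    then show "c e = 0" using u[OF e] by simp
  qed
qed

lemma independent_family_mono:
  assumes "independent_family v J" "I \<subseteq> J" "finite J"
  shows "independent_family v I"
  using assms independent_family_iff finite_subset inj_on_subset real_vector.independent_mono image_mono
  by metis

lemma vector_matroid:
  assumes "finite E"
  shows "matroid \<lparr>ground = E, indeps = {I. I \<subseteq> E \<and> independent_family v I}\<rparr>"
proof
  let ?M = "\<lparr>ground = E, indeps = {I. I \<subseteq> E \<and> independent_family v I}\<rparr>"
  fix I J assume IJ: "I \<in> indeps ?M" "J \<in> indeps ?M" "card I < card J"
  then have sub: "I \<subseteq> E" "J \<subseteq> E" and fin: "finite I" "finite J"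
    using assms finite_subset by auto
  have I: "inj_on v I" "independent (v ` I)" and J: "inj_on v J" "independent (v ` J)"
    using IJ fin by (auto simp: independent_family_iff)
  have "\<not> v ` J \<subseteq> span (v ` I)"
  proof
    assume "v ` J \<subseteq> span (v ` I)"
    then have "card (v ` J) \<le> card (v ` I)"
      using independent_span_bound[of "v ` I" "v ` J"] fin J(2) by blast
    then show False using I J IJ(3) by (simp add: card_image)
  qed
  then obtain e where e: "e \<in> J" "v e \<notin> span (v ` I)" by blast
  then have "v e \<notin> v ` I" using span_base by blast
  then have "e \<notin> I" by blast
  have "independent (insert (v e) (v ` I))"
    using e(2) I(2) by (simp add: independent_insert)
  then have "independent_family v (insert e I)"
    using fin I(1) \<open>v e \<notin> v ` I\<close> \<open>e \<notin> I\<close> by (auto simp: independent_family_iff)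
  then show "\<exists>e\<in>J - I. insert e I \<in> indeps ?M"
    using e(1) sub \<open>e \<notin> I\<close> by auto
next
  fix I J assume "J \<in> indeps \<lparr>ground = E, indeps = {I. I \<subseteq> E \<and> independent_family v I}\<rparr>" "I \<subseteq> J"
  then show "I \<in> indeps \<lparr>ground = E, indeps = {I. I \<subseteq> E \<and> independent_family v I}\<rparr>"
    using assms finite_subset[of J E] independent_family_mono[of v J I] by auto
qed (use assms in \<open>auto simp: independent_family_def\<close>)

text \<open>If a circuit met both sides, its two traces would be proper subsets and so independent
  in their summands. Then their union, the circuit itself, would be independent.\<close>

lemma direct_sum_circuit:
  assumes "matroid M" "matroid M1" "matroid M2" "ground M1 \<inter> ground M2 = {}"
    and sum: "M = matroid_direct_sum M1 M2"
    and C: "C \<subseteq> ground M" "C \<notin> indeps M" "\<And>e. e \<in> C \<Longrightarrow> C - {e} \<in> indeps M"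
  shows "C \<subseteq> ground M1 \<or> C \<subseteq> ground M2"
proof (rule ccontr)
  assume not: "\<not> (C \<subseteq> ground M1 \<or> C \<subseteq> ground M2)"
  interpret M: matroid M by fact
  interpret M1: matroid M1 by fact
  interpret M2: matroid M2 by fact
  have ground: "ground M = ground M1 \<union> ground M2"
    and indeps: "indeps M = {I \<union> J | I J. I \<in> indeps M1 \<and> J \<in> indeps M2}"
    using sum by (simp_all add: matroid_direct_sum_def)
  obtain e f where e: "e \<in> C" "e \<notin> ground M1" and f: "f \<in> C" "f \<notin> ground M2"
    using not by blast
  have "C \<inter> ground M1 \<in> indeps M"
    by (rule M.indep_mono[OF C(3)[OF e(1)]]) (use e in blast)
  then obtain I J where "C \<inter> ground M1 = I \<union> J" "I \<in> indeps M1" "J \<in> indeps M2"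
    unfolding indeps by blast
  moreover from this have "J = {}" using M2.indeps_subset assms(4) by blast
  ultimately have 1: "C \<inter> ground M1 \<in> indeps M1" by simp
  have "C \<inter> ground M2 \<in> indeps M"
    by (rule M.indep_mono[OF C(3)[OF f(1)]]) (use f in blast)
  then obtain I J where "C \<inter> ground M2 = I \<union> J" "I \<in> indeps M1" "J \<in> indeps M2"
    unfolding indeps by blast
  moreover from this have "I = {}" using M1.indeps_subset assms(4) by blast
  ultimately have 2: "C \<inter> ground M2 \<in> indeps M2" by simp
  have "C = (C \<inter> ground M1) \<union> (C \<inter> ground M2)" using C(1) ground by blast
  then have "C \<in> indeps M" using 1 2 unfolding indeps by blast
  with C(2) show False by blast
qed

lemma (in matroid) flat_memI_triple:
  assumes "matroid_simple M" "flat F" "x \<in> F" "y \<in> F" "z \<in> ground M" "x \<noteq> y" "{x, y, z} \<notin> indeps M"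
  shows "z \<in> F"
proof (rule flat_memI[OF assms(2) _ assms(5), of "{x, y}"])
  have xy: "{x, y} \<in> indeps M"
    using simple_indep_pair assms flat_subset_ground by blast
  obtain I where I: "I \<in> indeps M" "I \<subseteq> {x, y, z}" "card I = rk {x, y, z}"
    using ex_indep_card_eq_rank by blast
  then have "I \<subset> {x, y, z}" using assms(7) by blast
  then have "card I < card {x, y, z}" by (intro psubset_card_mono) auto
  also have "\<dots> \<le> 3" by (simp add: card_insert_if)
  finally have "card I \<le> rk {x, y}" using rank_indep[OF xy] assms(6) by simp
  moreover have "rk {x, y} \<le> rk {x, y, z}" by (rule rank_mono) auto
  ultimately show "rk (insert z {x, y}) = rk {x, y}"
    using I(3) by (simp add: insert_commute)
qed (use assms in auto)

text \<open>Five lines glued along a tree: \<open>{0, 1, 2, 3}\<close>, \<open>{0, 4, 5}\<close> and \<open>{0, 6, 7}\<close> meet in \<open>0\<close>,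
  the lines \<open>{6, 8, 9}\<close> and \<open>{7, 10, 11}\<close> are attached to the last of them.\<close>

definition tree_vec :: "nat \<Rightarrow> real \<times> real \<times> real \<times> real \<times> real \<times> real" where
  "tree_vec e = [(1,0,0,0,0,0), (0,1,0,0,0,0), (1,1,0,0,0,0), (1,2,0,0,0,0),
     (0,0,1,0,0,0), (1,0,1,0,0,0), (0,0,0,1,0,0), (1,0,0,1,0,0),
     (0,0,0,0,1,0), (0,0,0,1,1,0), (0,0,0,0,0,1), (1,0,0,1,0,1)] ! e"

definition tree_matroid :: "nat matroid" where
  "tree_matroid = \<lparr>ground = {..<12}, indeps = {I. I \<subseteq> {..<12} \<and> independent_family tree_vec I}\<rparr>"

lemma tree_ground [simp]: "ground tree_matroid = {..<12}"
  by (simp add: tree_matroid_def)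

interpretation tree: matroid tree_matroid
  unfolding tree_matroid_def by (rule vector_matroid) simp

lemma tree_vec_simps:
  "tree_vec 0 = (1,0,0,0,0,0)" "tree_vec (Suc 0) = (0,1,0,0,0,0)" "tree_vec 1 = (0,1,0,0,0,0)" "tree_vec 2 = (1,1,0,0,0,0)"
  "tree_vec 3 = (1,2,0,0,0,0)" "tree_vec 4 = (0,0,1,0,0,0)" "tree_vec 5 = (1,0,1,0,0,0)"
  "tree_vec 6 = (0,0,0,1,0,0)" "tree_vec 7 = (1,0,0,1,0,0)" "tree_vec 8 = (0,0,0,0,1,0)"
  "tree_vec 9 = (0,0,0,1,1,0)" "tree_vec 10 = (0,0,0,0,0,1)" "tree_vec 11 = (1,0,0,1,0,1)"
  by (simp_all add: tree_vec_def)

lemma lessThan_12: "{..<12::nat} = {0,1,2,3,4,5,6,7,8,9,10,11}"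
  by (auto simp: lessThan_nat_numeral)

lemma tree_representable: "real_representable tree_matroid"
  unfolding real_representable_def
proof (intro exI)
  define A :: "nat \<Rightarrow> nat \<Rightarrow> real" where
    "A i e = (case tree_vec e of (a, b, c, d, f, g) \<Rightarrow> [a, b, c, d, f, g] ! i)" for i e
  have "(\<Sum>e\<in>I. c e *\<^sub>R tree_vec e) = 0 \<longleftrightarrow> (\<forall>i<6. (\<Sum>e\<in>I. c e * A i e) = 0)" for I c
  proof -
    have A: "A 0 e = fst (tree_vec e)" "A 1 e = fst (snd (tree_vec e))"
      "A 2 e = fst (snd (snd (tree_vec e)))" "A 3 e = fst (snd (snd (snd (tree_vec e))))"
      "A 4 e = fst (snd (snd (snd (snd (tree_vec e)))))"
      "A 5 e = snd (snd (snd (snd (snd (tree_vec e)))))" for e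
      by (simp_all add: A_def split_beta)
    have "(\<Sum>e\<in>I. c e *\<^sub>R tree_vec e) = ((\<Sum>e\<in>I. c e * A 0 e), (\<Sum>e\<in>I. c e * A 1 e), (\<Sum>e\<in>I. c e * A 2 e),
        (\<Sum>e\<in>I. c e * A 3 e), (\<Sum>e\<in>I. c e * A 4 e), (\<Sum>e\<in>I. c e * A 5 e))"
      unfolding A by (intro prod_eqI)
        (simp_all only: fst_conv snd_conv fst_sum snd_sum fst_scaleR snd_scaleR real_scaleR_def)
    moreover have "{..<6::nat} = {0, 1, 2, 3, 4, 5}"
      by (auto simp: lessThan_nat_numeral)
    then have "(\<forall>i<6. P i) \<longleftrightarrow> P 0 \<and> P 1 \<and> P 2 \<and> P 3 \<and> P 4 \<and> P (5::nat)" for P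
      unfolding lessThan_iff[symmetric] Ball_def[symmetric] by simp
    ultimately show ?thesis by (simp add: zero_prod_def)
  qed
  then show "indeps tree_matroid = {I. I \<subseteq> ground tree_matroid \<and>
      (\<forall>c. (\<forall>i<6. (\<Sum>e\<in>I. c e * A i e) = 0) \<longrightarrow> (\<forall>e\<in>I. c e = 0))}"
    by (simp add: tree_matroid_def independent_family_def)
qed

lemma tree_simple: "matroid_simple tree_matroid"
proof -
  have "independent_family tree_vec {e, f}" if "e < 12" "f < 12" for e f
  proof (cases "e = f")
    case True
    have "tree_vec e \<noteq> 0"
      using that(1) unfolding lessThan_iff[symmetric] lessThan_12 by (auto simp: tree_vec_simps zero_prod_def)
    then show ?thesis using True by (simp add: independent_family_def)
  next
    case False
    have "x = 0 \<and> y = 0" if "x *\<^sub>R tree_vec e + y *\<^sub>R tree_vec f = 0" for x y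
      using that False \<open>e < 12\<close> \<open>f < 12\<close> unfolding lessThan_iff[symmetric] lessThan_12
      by (elim insertE emptyE) (simp_all add: tree_vec_simps zero_prod_def)
    then show ?thesis using False by (auto simp: independent_family_def)
  qed
  then have *: "{e, f} \<in> indeps tree_matroid" if "e < 12" "f < 12" for e f
    using that by (auto simp: tree_matroid_def)
  have "e < 12" if "{e} \<in> indeps tree_matroid" for e
    using tree.indeps_subset[OF that] by simp
  then show ?thesis
    using * *[of e e for e] by (auto simp: matroid_simple_def matroid_loop_def matroid_parallel_def)
qed

lemma tree_dependent:
  assumes "tree_vec z = a *\<^sub>R tree_vec x + b *\<^sub>R tree_vec y" "x \<noteq> y" "x \<noteq> z" "y \<noteq> z"
  shows "{x, y, z} \<notin> indeps tree_matroid"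
proof
  assume "{x, y, z} \<in> indeps tree_matroid"
  then have "independent_family tree_vec {x, y, z}" by (simp add: tree_matroid_def)
  moreover define c where "c = (\<lambda>e. if e = x then a else if e = y then b else -1)"
  have "(\<Sum>e\<in>{x, y, z}. c e *\<^sub>R tree_vec e) = 0"
    using assms by (simp add: c_def)
  ultimately have "c z = 0" unfolding independent_family_def by blast
  then show False using assms by (simp add: c_def)
qed

lemma tree_circuits:
  "{0, 1, 2} \<notin> indeps tree_matroid" "{0, 1, 3} \<notin> indeps tree_matroid"
  "{0, 2, 3} \<notin> indeps tree_matroid" "{0, 4, 5} \<notin> indeps tree_matroid"
  "{0, 6, 7} \<notin> indeps tree_matroid" "{6, 8, 9} \<notin> indeps tree_matroid"
  "{7, 10, 11} \<notin> indeps tree_matroid"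
  \<comment> \<open>The third vector of a triple is the sum of the first two, except that on the
    four-point line the vector of 3 is that of 0 plus twice that of 1, or twice that of 2 minus that
    of 0.\<close>
  by (rule tree_dependent[of _ 1 _ 1] tree_dependent[of _ 1 _ 2] tree_dependent[of _ "-1" _ 2];
      simp add: tree_vec_simps; fail)+

text \<open>A dependent triple is a circuit, as all pairs are independent, and so lies in one
  summand. The summand containing 0 absorbs the lines through 0 and then those attached at 6 and
  7.\<close>

lemma tree_connected: "matroid_connected tree_matroid"
  unfolding matroid_connected_def
proof
  assume "\<exists>M1 M2. matroid M1 \<and> matroid M2 \<and> ground M1 \<noteq> {} \<and> ground M2 \<noteq> {} \<and>
        ground M1 \<inter> ground M2 = {} \<and> tree_matroid = matroid_direct_sum M1 M2"
  then obtain M1 M2 where M: "matroid M1" "matroid M2" "ground M1 \<noteq> {}" "ground M2 \<noteq> {}"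
    "ground M1 \<inter> ground M2 = {}" "tree_matroid = matroid_direct_sum M1 M2"
    by blast
  have g: "{..<12} = ground M1 \<union> ground M2"
    using arg_cong[OF M(6), of ground] by (simp add: matroid_direct_sum_def)
  have circuit: "{x, y, z} \<subseteq> ground M1 \<or> {x, y, z} \<subseteq> ground M2"
    if "{x, y, z} \<notin> indeps tree_matroid" "x < 12" "y < 12" "z < 12" for x y z
  proof (rule direct_sum_circuit[OF tree.matroid_axioms M(1,2,5,6) _ that(1)])
    show "{x, y, z} \<subseteq> ground tree_matroid" using that by simp
    fix e assume "e \<in> {x, y, z}"
    then have "{x, y, z} - {e} \<subseteq> {y, z} \<or> {x, y, z} - {e} \<subseteq> {x, z} \<or> {x, y, z} - {e} \<subseteq> {x, y}"
      by auto
    moreover have "{y, z} \<in> indeps tree_matroid" "{x, z} \<in> indeps tree_matroid"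
      "{x, y} \<in> indeps tree_matroid"
      using that by (auto intro!: tree.simple_indep_pair[OF tree_simple])
    ultimately show "{x, y, z} - {e} \<in> indeps tree_matroid"
      using tree.indep_mono by metis
  qed
  have all: "{..<12} \<subseteq> A" if "0 \<in> A" "A \<inter> B = {}"
    and AB: "\<And>x y z. {x, y, z} \<notin> indeps tree_matroid \<Longrightarrow> x < 12 \<Longrightarrow> y < 12 \<Longrightarrow> z < 12 \<Longrightarrow>
      {x, y, z} \<subseteq> A \<or> {x, y, z} \<subseteq> B" for A B
  proof -
    have *: "y \<in> A \<and> z \<in> A"
      if "{x, y, z} \<notin> indeps tree_matroid" "x < 12" "y < 12" "z < 12" "x \<in> A" for x y z
      using AB[OF that(1-4)] that(5) \<open>A \<inter> B = {}\<close> by blast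
    have "1 \<in> A \<and> 2 \<in> A" "3 \<in> A" "4 \<in> A \<and> 5 \<in> A" "6 \<in> A \<and> 7 \<in> A"
      using *[OF tree_circuits(1)] *[OF tree_circuits(2)] *[OF tree_circuits(4)]
        *[OF tree_circuits(5)] \<open>0 \<in> A\<close> by simp_all
    moreover from this have "8 \<in> A \<and> 9 \<in> A" "10 \<in> A \<and> 11 \<in> A"
      using *[OF tree_circuits(6)] *[OF tree_circuits(7)] by simp_all
    ultimately show ?thesis using \<open>0 \<in> A\<close> unfolding lessThan_12 by simp
  qed
  have "0 \<in> {..<12::nat}" by simp
  then have "0 \<in> ground M1 \<or> 0 \<in> ground M2" unfolding g by (rule UnE) auto
  then have "{..<12} \<subseteq> ground M1 \<or> {..<12} \<subseteq> ground M2"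
  proof
    assume "0 \<in> ground M1"
    from all[OF this M(5) circuit] show ?thesis by simp
  next
    assume "0 \<in> ground M2"
    moreover have "ground M2 \<inter> ground M1 = {}" using M(5) by blast
    moreover have "{x, y, z} \<subseteq> ground M2 \<or> {x, y, z} \<subseteq> ground M1"
      if "{x, y, z} \<notin> indeps tree_matroid" "x < 12" "y < 12" "z < 12" for x y z
      using circuit[OF that] by (rule disj_commute[THEN iffD1])
    ultimately have "{..<12} \<subseteq> ground M2" by (rule all)
    then show ?thesis ..
  qed
  then show False using g M(3-5) by blast
qed

section \<open>Flats of the tree matroid and their ranks\<close>

lemma (in matroid) flat_cover_exists:
  assumes "flat F" "F \<noteq> ground M"
  obtains G where "flat G" "F \<subset> G" "rk G = Suc (rk F)"
proof -
  obtain e where e: "e \<in> ground M" "e \<notin> F"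
    using assms flat_subset_ground by blast
  have sub: "insert e F \<subseteq> ground M"
    using e flat_subset_ground[OF assms(1)] by auto
  have "rk F < rk (insert e F)" using assms(1) e by (auto simp: flat_def)
  then have "rk (insert e F) = Suc (rk F)" using rank_insert_le[of e F] by linarith
  then show ?thesis
    using that[OF flat_closure[OF sub]] rank_closure[OF sub] subset_closure[OF sub] e(2) by auto
qed

text \<open>Equivalently, \<open>F\<close> does not contain exactly two of the three points. The
  propositional form allows Boolean case analysis.\<close>

definition triple_closed :: "nat set \<Rightarrow> nat \<Rightarrow> nat \<Rightarrow> nat \<Rightarrow> bool" where
  "triple_closed F q x y \<longleftrightarrow>
    (q \<in> F \<longrightarrow> (x \<in> F \<longleftrightarrow> y \<in> F)) \<and> (q \<notin> F \<longrightarrow> \<not> (x \<in> F \<and> y \<in> F))"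

definition line_closed :: "nat set \<Rightarrow> bool" where
  "line_closed F \<longleftrightarrow> F \<subseteq> {..<12} \<and>
    triple_closed F 0 1 2 \<and> triple_closed F 0 1 3 \<and> triple_closed F 0 2 3 \<and>
    triple_closed F 0 4 5 \<and> triple_closed F 0 6 7 \<and> triple_closed F 6 8 9 \<and> triple_closed F 7 10 11"

text \<open>A block consists of the points of a line other than the point at which the line is attached;
  the root \<open>0\<close> is a block on its own. The rank of a flat is the number of blocks it meets.\<close>

definition block :: "nat \<Rightarrow> nat set" where
  "block i = [{0}, {1, 2, 3}, {4, 5}, {6, 7}, {8, 9}, {10, 11}] ! i"

definition blocks_met :: "nat set \<Rightarrow> nat set" where
  "blocks_met F = {i. i < 6 \<and> block i \<inter> F \<noteq> {}}"

lemma mem_blocks_met: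
  "0 \<in> blocks_met F \<longleftrightarrow> 0 \<in> F"
  "1 \<in> blocks_met F \<longleftrightarrow> 1 \<in> F \<or> 2 \<in> F \<or> 3 \<in> F"
  "2 \<in> blocks_met F \<longleftrightarrow> 4 \<in> F \<or> 5 \<in> F"
  "3 \<in> blocks_met F \<longleftrightarrow> 6 \<in> F \<or> 7 \<in> F"
  "4 \<in> blocks_met F \<longleftrightarrow> 8 \<in> F \<or> 9 \<in> F"
  "5 \<in> blocks_met F \<longleftrightarrow> 10 \<in> F \<or> 11 \<in> F"
  by (auto simp: blocks_met_def block_def)

lemma finite_blocks_met [simp]: "finite (blocks_met F)"
  by (simp add: blocks_met_def)

lemma blocks_met_subset: "blocks_met F \<subseteq> {0, 1, 2, 3, 4, 5}"
  by (auto simp: blocks_met_def)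

lemma blocks_met_mono: "F \<subseteq> G \<Longrightarrow> blocks_met F \<subseteq> blocks_met G"
  by (auto simp: blocks_met_def)

lemma flat_line_closed:
  assumes "tree.flat F"
  shows "line_closed F"
proof -
  have sub: "F \<subseteq> {..<12}" using tree.flat_subset_ground[OF assms] by simp
  have memI: "z \<in> F" if "{x, y, z} \<notin> indeps tree_matroid" "x \<in> F" "y \<in> F" "x \<noteq> y" "z < 12" for x y z
    using tree.flat_memI_triple[OF tree_simple assms that(2,3) _ that(4) that(1)] that(5) by simp
  have triple: "triple_closed F q x y"
    if *: "{q, x, y} \<notin> indeps tree_matroid" "q < 12" "x < 12" "y < 12" "q \<noteq> x" "q \<noteq> y" "x \<noteq> y" for q x y
  proof -
    have "{q, y, x} \<notin> indeps tree_matroid" "{x, y, q} \<notin> indeps tree_matroid"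
      using *(1) by (simp_all add: insert_commute)
    then show ?thesis
      unfolding triple_closed_def using memI[of q x y] memI[of q y x] memI[of x y q] * by blast
  qed
  show ?thesis
    unfolding line_closed_def
    by (intro conjI sub triple tree_circuits) simp_all
qed

text \<open>Suppose the same blocks are met and go outward from 0. If the attaching point of a line
  is in both sets, a block that is met is contained in both. If it is in neither, each set has at
  most one point of the block, and the inclusion makes these points equal. So the sets
  coincide.\<close>

lemma blocks_met_strict_mono:
  assumes "line_closed F" "line_closed G" "F \<subset> G"
  shows "blocks_met F \<subset> blocks_met G"
proof -
  have sub: "x \<in> F \<longrightarrow> x \<in> G" for x using assms(3) by blast
  note subs = sub[of 0] sub[of 1] sub[of 2] sub[of 3] sub[of 4] sub[of 5] sub[of 6] sub[of 7]
    sub[of 8] sub[of 9] sub[of 10] sub[of 11]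
  obtain e where e: "e \<in> G" "e \<notin> F" using assms(3) by blast
  then have "e \<in> {..<12}" using assms(2) by (auto simp: line_closed_def)
  have "blocks_met F \<noteq> blocks_met G"
  proof
    assume "blocks_met F = blocks_met G"
    then have "i \<in> blocks_met F \<longleftrightarrow> i \<in> blocks_met G" for i by simp
    note eq = this[of 0] this[of 1] this[of 2] this[of 3] this[of 4] this[of 5]
    have "x \<in> F" if "x \<in> G" "x \<in> {..<12}" for x
      using that(2,1) eq assms(1,2) subs
      unfolding lessThan_12 line_closed_def triple_closed_def mem_blocks_met
      by (elim insertE emptyE) (hypsubst, sat)+
    then show False using e \<open>e \<in> {..<12}\<close> by blast
  qed
  then show ?thesis using blocks_met_mono[of F G] assms(3) by blast
qed

lemma tree_rank: "tree.rk {..<12} = 6"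
proof (rule order_antisym)
  \<comment> \<open>The root and one point of each block; their vectors form the standard
    basis.\<close>
  let ?X = "{0, 1, 4, 6, 8, 10 :: nat}"
  have sub: "?X \<subseteq> ground tree_matroid" by simp
  have "{..<12} \<subseteq> C" if "line_closed C" "?X \<subseteq> C" for C
    using that by (simp add: line_closed_def triple_closed_def lessThan_12)
  then have "{..<12} \<subseteq> tree.closure ?X"
    using flat_line_closed[OF tree.flat_closure[OF sub]] tree.subset_closure[OF sub] by blast
  then have "tree.rk {..<12} \<le> tree.rk (tree.closure ?X)" by (rule tree.rank_mono)
  also have "\<dots> = tree.rk ?X" by (rule tree.rank_closure[OF sub])
  also have "\<dots> \<le> card ?X" by (rule tree.rank_le_card) simp
  finally show "tree.rk {..<12} \<le> 6" by simp
  have "?X \<in> indeps tree_matroid"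
    by (simp add: tree_matroid_def independent_family_def tree_vec_simps zero_prod_def)
  from tree.rank_ge_card[OF this, of "{..<12}"] show "6 \<le> tree.rk {..<12}" by simp
qed

text \<open>Climb from \<open>F\<close> to the ground set by covers. Each step adds exactly one to
  the rank and at least one block, the final rank is six, and there are only six blocks.\<close>

lemma card_blocks_met_le_rank:
  assumes "tree.flat F"
  shows "card (blocks_met F) \<le> tree.rk F"
  using assms
proof (induction "6 - tree.rk F" arbitrary: F rule: less_induct)
  case (less F)
  show ?case
  proof (cases "F = {..<12}")
    case True
    have "card (blocks_met F) \<le> card {0, 1, 2, 3, 4, 5 :: nat}"
      by (rule card_mono[OF _ blocks_met_subset]) simp
    then show ?thesis using True tree_rank by simp
  next
    case False
    then obtain G where G: "tree.flat G" "F \<subset> G" "tree.rk G = Suc (tree.rk F)"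
      using tree.flat_cover_exists[OF less.prems] by auto
    have "tree.rk G \<le> 6"
      using tree.rank_mono[OF tree.flat_subset_ground[OF G(1)]] by (simp add: tree_rank)
    then have "card (blocks_met G) \<le> tree.rk G"
      using less.hyps[OF _ G(1)] G(3) by simp
    moreover have "card (blocks_met F) < card (blocks_met G)"
      using blocks_met_strict_mono[OF flat_line_closed[OF less.prems] flat_line_closed[OF G(1)] G(2)]
      by (intro psubset_card_mono) simp_all
    ultimately show ?thesis using G(3) by simp
  qed
qed

section \<open>No even flag reaches the ground set\<close>

lemma odd_card_iff:
  fixes F :: "nat set"
  assumes "F \<subseteq> {..<12}"
  shows "odd (card F) \<longleftrightarrow> ((0 \<in> F) \<noteq> ((1 \<in> F) \<noteq> ((2 \<in> F) \<noteq> ((3 \<in> F) \<noteq> ((4 \<in> F) \<noteq> ((5 \<in> F) \<noteq>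
    ((6 \<in> F) \<noteq> ((7 \<in> F) \<noteq> ((8 \<in> F) \<noteq> ((9 \<in> F) \<noteq> ((10 \<in> F) \<noteq> (11 \<in> F))))))))))))"
proof -
  have "card F = (\<Sum>e\<in>{..<12}. of_bool (e \<in> F))"
    using assms by (simp add: Int_absorb1)
  then show ?thesis
    unfolding lessThan_12 by (simp del: sum_of_bool_eq)
qed

text \<open>An invariant of flags of flats of even nullity: the trace of \<open>F\<close> on the union of the lines
  \<open>{0, 6, 7}\<close>, \<open>{6, 8, 9}\<close>, \<open>{7, 10, 11}\<close> has even nullity (the contribution of \<open>0\<close> cancels), or
  it is \<open>{0, 6, 7}\<close>, and then every larger trace is out of reach: adding \<open>8\<close> or \<open>10\<close> adds two
  points. The full trace has nullity three.\<close>

definition even_trace :: "nat set \<Rightarrow> bool" where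
  "even_trace F \<longleftrightarrow>
    ((6 \<in> F) \<noteq> ((7 \<in> F) \<noteq> ((8 \<in> F) \<noteq> ((9 \<in> F) \<noteq> ((10 \<in> F) \<noteq> (11 \<in> F)))))) =
      ((6 \<in> F \<or> 7 \<in> F) \<noteq> ((8 \<in> F \<or> 9 \<in> F) \<noteq> (10 \<in> F \<or> 11 \<in> F))) \<or>
    0 \<in> F \<and> 6 \<in> F \<and> 7 \<in> F \<and> 8 \<notin> F \<and> 9 \<notin> F \<and> 10 \<notin> F \<and> 11 \<notin> F"

lemma even_trace_step:
  assumes "even_trace G" "line_closed G" "line_closed F" "G \<subset> F" "odd (card F) \<noteq> odd (card G)"
    and "card (blocks_met F) = Suc (card (blocks_met G))"
  shows "even_trace F"
proof -
  have sub: "x \<in> G \<longrightarrow> x \<in> F" for x using assms(4) by blast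
  have F: "F \<subseteq> {..<12}" and G: "G \<subseteq> {..<12}" using assms(2,3) by (simp_all add: line_closed_def)
  have mono: "blocks_met G \<subseteq> blocks_met F" using assms(4) by (intro blocks_met_mono) blast
  have "card (blocks_met F - blocks_met G) = 1"
    using assms(6) mono by (simp add: card_Diff_subset)
  then obtain j where j: "blocks_met F - blocks_met G = {j}" by (rule card_1_singletonE)
  then have new: "j \<in> blocks_met F" "j \<notin> blocks_met G" by blast+
  then have "j \<in> {0, 1, 2, 3, 4, 5}" using blocks_met_subset by blast
  have other: "i \<in> blocks_met F \<longleftrightarrow> i \<in> blocks_met G" if "i \<noteq> j" for i
    using j mono that by blast
  note s = sub[of 0] sub[of 1] sub[of 2] sub[of 3] sub[of 4] sub[of 5] sub[of 6] sub[of 7] sub[of 8]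
    sub[of 9] sub[of 10] sub[of 11]
  note trace = assms(1)[unfolded even_trace_def]
  note closed = assms(2,3)[unfolded line_closed_def triple_closed_def]
  consider "j = 0" | "j = 1 \<or> j = 2" | "j = 3 \<or> j = 4 \<or> j = 5"
    using \<open>j \<in> {0, 1, 2, 3, 4, 5}\<close> by blast
  then show ?thesis
  proof cases
    case 1
    \<comment> \<open>When the root enters, a lone 6 or 7 brings its partner. If the block attached
      at the partner is met, it gets its second point too, and the parity of the trace is kept.
      Otherwise the trace of \<open>G\<close> is just that lone point, since the block attached at
      it would make the nullity odd, and the new trace is \<open>{0, 6, 7}\<close>.\<close>
    have zero: "0 \<in> F" "0 \<notin> G"
      using new unfolding 1 mem_blocks_met by simp_all
    have "3 \<in> blocks_met F \<longleftrightarrow> 3 \<in> blocks_met G" "4 \<in> blocks_met F \<longleftrightarrow> 4 \<in> blocks_met G"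
      "5 \<in> blocks_met F \<longleftrightarrow> 5 \<in> blocks_met G"
      using 1 by (simp_all add: other)
    moreover have "triple_closed G 0 6 7" "triple_closed G 6 8 9" "triple_closed G 7 10 11"
      "triple_closed F 0 6 7" "triple_closed F 6 8 9" "triple_closed F 7 10 11"
      using assms(2,3) by (simp_all add: line_closed_def)
    ultimately show ?thesis
      using zero trace s(7-12) unfolding triple_closed_def mem_blocks_met even_trace_def by sat
  next
    case 2
    have "0 \<in> blocks_met F \<longleftrightarrow> 0 \<in> blocks_met G" "3 \<in> blocks_met F \<longleftrightarrow> 3 \<in> blocks_met G"
      "4 \<in> blocks_met F \<longleftrightarrow> 4 \<in> blocks_met G" "5 \<in> blocks_met F \<longleftrightarrow> 5 \<in> blocks_met G"
      using 2 by (auto simp: other)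
    note this[unfolded mem_blocks_met]
    then have "0 \<in> F \<longleftrightarrow> 0 \<in> G" "6 \<in> F \<longleftrightarrow> 6 \<in> G" "7 \<in> F \<longleftrightarrow> 7 \<in> G" "8 \<in> F \<longleftrightarrow> 8 \<in> G"
      "9 \<in> F \<longleftrightarrow> 9 \<in> G" "10 \<in> F \<longleftrightarrow> 10 \<in> G" "11 \<in> F \<longleftrightarrow> 11 \<in> G"
      using s closed by sat+
    then show ?thesis using assms(1) by (simp only: even_trace_def)
  next
    case 3
    have "0 \<in> blocks_met F \<longleftrightarrow> 0 \<in> blocks_met G" "1 \<in> blocks_met F \<longleftrightarrow> 1 \<in> blocks_met G"
      "2 \<in> blocks_met F \<longleftrightarrow> 2 \<in> blocks_met G"
      using 3 by (auto simp: other)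
    note this[unfolded mem_blocks_met]
    then have A: "0 \<in> F \<longleftrightarrow> 0 \<in> G" "1 \<in> F \<longleftrightarrow> 1 \<in> G" "2 \<in> F \<longleftrightarrow> 2 \<in> G" "3 \<in> F \<longleftrightarrow> 3 \<in> G"
      "4 \<in> F \<longleftrightarrow> 4 \<in> G" "5 \<in> F \<longleftrightarrow> 5 \<in> G"
      using s closed by sat+
    \<comment> \<open>The unchanged points 0 to 5 drop out of the parities, so an odd number of
      points is added among 6 to 11. This balances the one new block. From the trace
      \<open>{0, 6, 7}\<close> a new block would bring in exactly two points, which is
      excluded.\<close>
    have cancel: "((a \<noteq> x) \<noteq> (a \<noteq> y)) = (x \<noteq> y)" for a x y :: bool by blast
    note parity = assms(5)[unfolded odd_card_iff[OF F] odd_card_iff[OF G] A cancel]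
    let ?new = "\<lambda>i. i \<in> blocks_met F \<and> i \<notin> blocks_met G"
    let ?old = "\<lambda>i. i \<in> blocks_met F \<longleftrightarrow> i \<in> blocks_met G"
    have "?new 3 \<and> ?old 4 \<and> ?old 5 \<or> ?old 3 \<and> ?new 4 \<and> ?old 5 \<or> ?old 3 \<and> ?old 4 \<and> ?new 5"
      using 3 new by (auto simp: other)
    moreover have "triple_closed G 0 6 7" "triple_closed G 6 8 9" "triple_closed G 7 10 11"
      "triple_closed F 0 6 7" "triple_closed F 6 8 9" "triple_closed F 7 10 11"
      using assms(2,3) by (simp_all add: line_closed_def)
    ultimately show ?thesis
      using parity trace s(7-12) A(1) unfolding triple_closed_def mem_blocks_met even_trace_def by sat
  qed
qed

text \<open>The rank bound, with the general inequality, means that rank and number of blocks agree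
  along the flag. Hence each step meets exactly one new block, and equal nullity parities make the
  size change parity, as \<open>even_trace_step\<close> requires.\<close>

lemma even_flag_trace:
  assumes "tree.even_flag F"
  shows "tree.flat F \<and> tree.rk F \<le> card (blocks_met F) \<and> even_trace F"
  using assms
proof (induction rule: tree.even_flag.induct)
  case even_flag_empty
  show ?case using tree.simple_flat_empty[OF tree_simple] by (simp add: even_trace_def)
next
  case (even_flag_step G F)
  then have G: "tree.flat G" "tree.rk G = card (blocks_met G)" "even_trace G"
    using card_blocks_met_le_rank[of G] by auto
  have closed: "line_closed G" "line_closed F"
    using flat_line_closed G(1) even_flag_step.hyps by auto
  have "card (blocks_met G) < card (blocks_met F)"
    using blocks_met_strict_mono[OF closed] even_flag_step.hyps by (intro psubset_card_mono) simp_all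
  then have card: "card (blocks_met F) = Suc (card (blocks_met G))"
    using card_blocks_met_le_rank[of F] even_flag_step.hyps G(2) by simp
  have "even (card G + tree.rk G)" "even (card F + tree.rk F)"
    using tree.even_flag_sign[OF even_flag_step.hyps(1)] even_flag_step.hyps(5)
    by (auto simp: tree.nullity_sign_def uminus_power_if split: if_splits)
  then have "odd (card F) \<noteq> odd (card G)" using even_flag_step.hyps(4) by auto
  then show ?case
    using even_trace_step[OF G(3) closed] even_flag_step.hyps card G(2) by simp
qed

lemma not_even_flag: "\<not> tree.even_flag {..<12}"
  using even_flag_trace[of "{..<12}"] by (auto simp: even_trace_def)

text \<open>The segment is line-closed, meets \<open>i\<close> blocks and lies in the closure of
  \<open>i\<close> chosen points. A strictly larger closure would meet more than \<open>i\<close>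
  blocks with rank at most \<open>i\<close>. The first case is the four-point line; each later one
  adds a three-point line.\<close>

lemma
  assumes "2 \<le> i" "i \<le> 6"
  shows flat_initial: "tree.flat {..<2 * i}" and rank_initial: "tree.rk {..<2 * i} = i"
proof -
  let ?X = "set (take i [0, 1, 4, 6, 8, 10 :: nat])" and ?K = "{..<2 * i}"
  have i: "i \<in> {2, 3, 4, 5, 6}" using assms by auto
  have sub: "?X \<subseteq> ground tree_matroid" by (rule subset_trans[OF set_take_subset]) auto
  have flat: "tree.flat (tree.closure ?X)" by (rule tree.flat_closure[OF sub])
  have "?K \<subseteq> C" if "line_closed C" "?X \<subseteq> C" for C
    using i that
    by (elim insertE emptyE) (auto simp: line_closed_def triple_closed_def lessThan_nat_numeral)
  then have K: "?K \<subseteq> tree.closure ?X"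
    using flat_line_closed[OF flat] tree.subset_closure[OF sub] by blast
  have "tree.rk (tree.closure ?X) \<le> card ?X"
    unfolding tree.rank_closure[OF sub] by (rule tree.rank_le_card) simp
  also have "\<dots> \<le> i" using card_length[of "take i [0, 1, 4, 6, 8, 10 :: nat]"] by simp
  finally have rank: "tree.rk (tree.closure ?X) \<le> i" .
  have met: "card (blocks_met ?K) = i"
  proof -
    have "blocks_met ?K = {..<i}"
      using i by (elim insertE emptyE) (auto simp: blocks_met_def block_def less_Suc_eq numeral_eq_Suc)
    then show ?thesis by simp
  qed
  have closed: "line_closed ?K"
    using i by (elim insertE emptyE) (simp_all add: line_closed_def triple_closed_def)
  have eq: "tree.closure ?X = ?K"
  proof (rule ccontr)
    assume "tree.closure ?X \<noteq> ?K"
    with K have "?K \<subset> tree.closure ?X" by blast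
    from psubset_card_mono[OF _ blocks_met_strict_mono[OF closed flat_line_closed[OF flat] this]]
    have "i < card (blocks_met (tree.closure ?X))" by (simp add: met)
    with card_blocks_met_le_rank[OF flat] rank show False by simp
  qed
  then show "tree.flat ?K" using flat by simp
  show "tree.rk ?K = i"
    using eq rank met card_blocks_met_le_rank[OF flat] by simp
qed

lemma quarter_flag_initial:
  assumes "2 \<le> i" "i \<le> 6"
  shows "tree.quarter_flag {..<2 * i}"
proof -
  \<comment> \<open>Rank \<open>i\<close> and size \<open>2 * i\<close> give the sign
    \<open>(-1) ^ (3 * i)\<close>, which has the same value as
    \<open>\<i> ^ (2 * i)\<close>.\<close>
  have ff: "tree.flat_factor {..<2 * i} \<i> = 1" if "2 \<le> i" "i \<le> 6" for i
    using rank_initial[OF that]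
    by (simp add: tree.flat_factor_def tree.nullity_sign_def power_mult power_add flip: power_mult_distrib)
  show ?thesis
    using assms
  proof (induction i rule: dec_induct)
    case base
    show ?case
      using flat_initial[of 2] rank_initial[of 2] ff[of 2] by (intro tree.quarter_flag_base) simp_all
  next
    case (step i)
    show ?case
      by (rule tree.quarter_flag_step[of "{..<2 * i}"])
        (use step flat_initial[of "Suc i"] rank_initial[of "Suc i"] rank_initial[of i] ff[of "Suc i"] in auto)
  qed
qed

theorem theorem5p5:
  shows "\<exists>M :: nat matroid.
    matroid M \<and> matroid_connected M \<and> matroid_simple M \<and> real_representable M \<and>
    matroid_rank M (ground M) = 6 \<and> card (ground M) = 12 \<and>
    infinite {l. magnitude_coeff M l < 0}"
proof -
  have "infinite {l. magnitude_coeff tree_matroid l < 0}"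
    using tree.infinitely_many_negative_coeffs[OF tree_simple] tree_rank not_even_flag
      quarter_flag_initial[of 6] by simp
  then show ?thesis
    using tree.matroid_axioms tree_connected tree_simple tree_representable tree_rank
    by (intro exI[of _ tree_matroid]) simp
qed

end
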